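(* Let $\mathcal{F}_2$ be the family of $K3$ surfaces parametrised by the complete anticanonical linear system of the toric Fano $3$-fold $\mathbb{P}_{\Delta_2}$, where $$\Delta_2=\mathrm{Conv}\{(-1,-1,1),(-1,2,-1),(3,-1,-1),(5,-1,-1),(-1,5,-1)\}.$$ The family $\mathcal{F}_2$ contains $K3$ surfaces that are double coverings of $\mathbb{P}^2$ branching along curves of $(2,3)$-torus type with singularities $$2A_5+E_6,\quad A_5+2E_6,\quad 3E_6,\quad 2A_2+A_5+E_6,\quad 2A_2+2E_6,\quad\text{and}\quad A_2+E_6+A_8.$$ That is, for each configuration in this list there is a curve $B=(F=0)$ of $(2,3)$-torus type with exactly this configuration of singularities such that the double covering $W^2-F(X,Y,Z)=0$ of $\mathbb{P}^2$ is a section in $\mathcal{F}_2$.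
   Context: Everything is over $\mathbb{C}$. A curve of $(2,3)$-torus type is a plane sextic curve in $\mathbb{P}^2$ (homogeneous coordinates $X,Y,Z$) defined by a polynomial $F=F_2^3+F_3^2$, with $F_i$ homogeneous of degree $i$, having at most simple (ADE) singularities. $A_n$ ($n\ge1$) denotes the plane curve singularity locally given by $x^2+y^{n+1}=0$ and $E_6$ the one locally given by $x^3+y^4=0$; a sum such as $2A_5+E_6$ lists all singular points of the curve with multiplicity. The double covering of $\mathbb{P}^2$ branched along $B=(F=0)$ is the Gorenstein $K3$ surface $W^2-F(X,Y,Z)=0$ in the weighted projective space $\mathbb{P}(1,1,1,3)$ with coordinates $X,Y,Z,W$ of weights $1,1,1,3$. A Gorenstein $K3$ surface (at most simple singularities, trivial canonical divisor, irregularity zero) is identified with the unique smooth $K3$ surface birational to it. Lattice points are identified with monomials of weighted degree $6$ by $$(a,b,c)\longleftrightarrow X^{a+1}\,Y^{b+1}\,Z^{1-a-b-3c}\,W^{c+1}.$$ For example $(-1,-1,1)\leftrightarrow W^2$, $(-1,2,-1)\leftrightarrow Y^3Z^3$, $(3,-1,-1)\leftrightarrow X^4Z^2$, $(5,-1,-1)\leftrightarrow X^6$, $(-1,5,-1)\leftrightarrow Y^6$. For a reflexive polytope $\Delta$, $\mathbb{P}_\Delta$ is the toric Fano $3$-fold whose fan consists of the cones over the faces of the polar dual $\Delta^*=\{y : \langle y,x\rangle\ge-1\ \forall x\in\Delta\}$; its anticanonical sections are the linear combinations of the monomials corresponding to the lattice points of $\Delta$. The surface $W^2-F=0$ is a section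 in the family when $W^2-F$ is such a linear combination. *)

theory Defs
  imports "HOL-Analysis.Analysis" "HOL-Library.Poly_Mapping" "HOL-Library.Multiset"
begin

text \<open>
  Polynomials over the complex numbers in \<open>X, Y, Z, W\<close>: the key \<open>(i, j, k, l)\<close> stands for the
  monomial \<open>X^i Y^j Z^k W^l\<close>.  The ring structure is the convolution product of
  \<^theory>\<open>HOL-Library.Poly_Mapping\<close>.
\<close>

type_synonym mpoly4 = "(nat \<times> nat \<times> nat \<times> nat) \<Rightarrow>\<^sub>0 complex"

definition mono4 :: "nat \<Rightarrow> nat \<Rightarrow> nat \<Rightarrow> nat \<Rightarrow> mpoly4" where
  "mono4 i j k l = Poly_Mapping.single (i, j, k, l) 1"

definition ternary_form :: "nat \<Rightarrow> mpoly4 \<Rightarrow> bool" where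
  "ternary_form d F \<longleftrightarrow> (\<forall>(i, j, k, l) \<in> Poly_Mapping.keys F. l = 0 \<and> i + j + k = d)"

text \<open>The value at \<open>(X, Y, Z) = v\<close> and \<open>W = 0\<close>; it is only used for forms in \<open>X, Y, Z\<close>.\<close>

definition form_eval :: "mpoly4 \<Rightarrow> complex ^ 3 \<Rightarrow> complex" where
  "form_eval F v = (\<Sum>(i, j, k, l) \<in> Poly_Mapping.keys F.
     Poly_Mapping.lookup F (i, j, k, l) * (v $ 1) ^ i * (v $ 2) ^ j * (v $ 3) ^ k * 0 ^ l)"


section \<open>Germs of holomorphic functions of two variables\<close>

text \<open>Complex differentiability: the Frechet derivative is a complex-linear form.\<close>

definition holomorphic2_on :: "(complex \<times> complex \<Rightarrow> complex) \<Rightarrow> (complex \<times> complex) set \<Rightarrow> bool" where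
  "holomorphic2_on f U \<longleftrightarrow>
     (\<forall>p \<in> U. \<exists>a b. (f has_derivative (\<lambda>(h, k). a * h + b * k)) (at p))"

definition biholomorphism ::
    "(complex \<times> complex) set \<Rightarrow> (complex \<times> complex) set \<Rightarrow>
     (complex \<times> complex \<Rightarrow> complex \<times> complex) \<Rightarrow> (complex \<times> complex \<Rightarrow> complex \<times> complex) \<Rightarrow> bool" where
  "biholomorphism U V \<phi> \<psi> \<longleftrightarrow> open U \<and> open V \<and> homeomorphism U V \<phi> \<psi> \<and>
     holomorphic2_on (fst \<circ> \<phi>) U \<and> holomorphic2_on (snd \<circ> \<phi>) U \<and>
     holomorphic2_on (fst \<circ> \<psi>) V \<and> holomorphic2_on (snd \<circ> \<psi>) V"

text \<open>
  The germs at the origin of the curves \<open>f = 0\<close> and \<open>g = 0\<close> are isomorphic: some local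
  biholomorphic change of coordinates fixing the origin turns \<open>f\<close> into \<open>g\<close> up to a
  nowhere vanishing holomorphic factor.  Comparing equations rather than zero sets keeps
  track of multiple components.
\<close>

definition isomorphic_germs :: "(complex \<times> complex \<Rightarrow> complex) \<Rightarrow> (complex \<times> complex \<Rightarrow> complex) \<Rightarrow> bool" where
  "isomorphic_germs f g \<longleftrightarrow>
     (\<exists>U V \<phi> \<psi> u. biholomorphism U V \<phi> \<psi> \<and> (0, 0) \<in> U \<and> \<phi> (0, 0) = (0, 0) \<and>
        holomorphic2_on u U \<and> (\<forall>p \<in> U. u p \<noteq> 0 \<and> f (\<phi> p) = u p * g p))"


section \<open>Simple plane curve singularities\<close>

datatype sing_type = Sing_A nat | Sing_D nat | Sing_E6 | Sing_E7 | Sing_E8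

fun ade :: "sing_type \<Rightarrow> bool" where
  "ade (Sing_A n) \<longleftrightarrow> n \<ge> 1"
| "ade (Sing_D n) \<longleftrightarrow> n \<ge> 4"
| "ade Sing_E6 \<longleftrightarrow> True"
| "ade Sing_E7 \<longleftrightarrow> True"
| "ade Sing_E8 \<longleftrightarrow> True"

fun normal_form :: "sing_type \<Rightarrow> complex \<times> complex \<Rightarrow> complex" where
  "normal_form (Sing_A n) (x, y) = x ^ 2 + y ^ (n + 1)"
| "normal_form (Sing_D n) (x, y) = x ^ 2 * y + y ^ (n - 1)"
| "normal_form Sing_E6 (x, y) = x ^ 3 + y ^ 4"
| "normal_form Sing_E7 (x, y) = x ^ 3 + x * y ^ 3"
| "normal_form Sing_E8 (x, y) = x ^ 3 + y ^ 5"


section \<open>Singularities of plane projective curves\<close>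

text \<open>A point of the projective plane is the class of its homogeneous coordinate vectors.\<close>

definition proj_rel :: "(complex ^ 3) rel" where
  "proj_rel = {(v, w). v \<noteq> 0 \<and> w \<noteq> 0 \<and> (\<exists>c. w = c *s v)}"

definition proj_plane :: "(complex ^ 3) set set" where
  "proj_plane = (- {0}) // proj_rel"

definition sing_points :: "mpoly4 \<Rightarrow> (complex ^ 3) set set" where
  "sing_points F = {P \<in> proj_plane. \<forall>v \<in> P.
     form_eval F v = 0 \<and> (form_eval F has_derivative (\<lambda>h. 0)) (at v)}"

text \<open>
  If \<open>v\<close> represents \<open>P\<close> and \<open>v, d, e\<close> form a basis, then \<open>(s, t) \<mapsto> [v + s d + t e]\<close> is an affine
  chart of the projective plane centred at \<open>P\<close>, in which the curve \<open>F = 0\<close> has the equation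
  \<open>F (v + s d + t e) = 0\<close>.
\<close>

definition has_sing_type :: "mpoly4 \<Rightarrow> (complex ^ 3) set \<Rightarrow> sing_type \<Rightarrow> bool" where
  "has_sing_type F P \<tau> \<longleftrightarrow>
     (\<exists>v d e. v \<in> P \<and> det (vector [v, d, e] :: complex ^ 3 ^ 3) \<noteq> 0 \<and>
        isomorphic_germs (\<lambda>(s, t). form_eval F (v + s *s d + t *s e)) (normal_form \<tau>))"

definition has_configuration :: "mpoly4 \<Rightarrow> sing_type multiset \<Rightarrow> bool" where
  "has_configuration F M \<longleftrightarrow> finite (sing_points F) \<and>
     (\<exists>\<tau>. (\<forall>P \<in> sing_points F. has_sing_type F P (\<tau> P)) \<and>
          image_mset \<tau> (mset_set (sing_points F)) = M)"

definition torus_type_23 :: "mpoly4 \<Rightarrow> bool" where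
  "torus_type_23 F \<longleftrightarrow> F \<noteq> 0 \<and>
     (\<exists>F2 F3. ternary_form 2 F2 \<and> ternary_form 3 F3 \<and> F = F2 ^ 3 + F3 ^ 2) \<and>
     (\<forall>P \<in> sing_points F. \<exists>\<tau>. ade \<tau> \<and> has_sing_type F P \<tau>)"


section \<open>Anticanonical sections\<close>

text \<open>
  The lattice point \<open>(a, b, c)\<close> corresponds to
  \<open>X^(a + 1) Y^(b + 1) Z^(1 - a - b - 3 c) W^(c + 1)\<close>, a monomial of degree 6 for the weights
  \<open>1, 1, 1, 3\<close>.
\<close>

definition lattice_monomials :: "(real \<times> real \<times> real) set \<Rightarrow> (nat \<times> nat \<times> nat \<times> nat) set" where
  "lattice_monomials \<Delta> = {(i, j, k, l). \<exists>a b c :: int.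
     (of_int a, of_int b, of_int c) \<in> \<Delta> \<and>
     int i = a + 1 \<and> int j = b + 1 \<and> int k = 1 - a - b - 3 * c \<and> int l = c + 1}"

text \<open>
  The anticanonical sections of the toric variety of a reflexive polytope, i.e. the linear
  combinations of the monomials of its lattice points.
\<close>

definition anticanonical_sections :: "(real \<times> real \<times> real) set \<Rightarrow> mpoly4 set" where
  "anticanonical_sections \<Delta> = {p. Poly_Mapping.keys p \<subseteq> lattice_monomials \<Delta>}"

definition Delta2 :: "(real \<times> real \<times> real) set" where
  "Delta2 = convex hull {(-1, -1, 1), (-1, 2, -1), (3, -1, -1), (5, -1, -1), (-1, 5, -1)}"

end

theory Submission imports Defs begin

text \<open>
  All six curves have \<open>F2 = X\<^sup>2 - Y Z\<close>.  The polytope asks exactly for a triple tangent \<open>Y = 0\<close> at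
  \<open>[0 : 0 : 1]\<close>, and \<open>F2 ^ 3 + F3 ^ 2\<close> has an \<open>E6\<close> with this tangent when the cubic \<open>F3\<close> is singular
  there and meets the conic with multiplicity 2.  On the conic, parametrised by \<open>[t : t\<^sup>2 : 1]\<close>, \<open>F3\<close>
  restricts to a sextic in \<open>t\<close>, where \<open>t = \<infinity>\<close> counts with the missing degree: a point where \<open>F3\<close> is
  smooth and meets the conic with multiplicity \<open>k\<close> gives \<open>A_(3 k - 1)\<close>, and a point of
  multiplicity 2 where \<open>F3\<close> is singular gives \<open>E6\<close>.  The cubics are chosen with the prescribed
  zeros among \<open>0, 1, -1, \<infinity>\<close>, and such that elimination from \<open>3 F3 dF2 = 2 F2 dF3\<close> excludes
  singularities off the conic.
\<close>

text \<open>Weight 3 for X and 4 for Y makes the polytope condition multiplicative: degree 6 and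
  weight at least 12 follow from weight 4 of the conic and weight 6 of the cubic. A cubic has weight
  at least 6 exactly when \<open>Z^3\<close>, \<open>X Z^2\<close> and \<open>Y Z^2\<close> are
  absent, that is, when it is singular at [0 : 0 : 1]; so the condition for E6 there and the
  membership in the family go together. The obstacle is that \<open>isomorphic_germs\<close> asks
  for a genuine biholomorphism at each singular point. It is enough to give germs x, y with
  independent differentials and an identity u f = v x^m + w y^n with units u, v, w: roots of units
  and one use of the inverse function theorem do the rest. In a chart such identities come from
  eliminating one affine coordinate with the equation of the conic or of the cubic, so that only
  polynomial algebra remains. The restriction to the conic determines a cubic up to a linear form
  times the conic. This freedom leaves the prescribed zeros alone and decides at which multiple
  zeros the cubic is singular.\<close>

section \<open>Holomorphic germs\<close>

text \<open>
  \<open>a\<close> and \<open>b\<close> are the partial derivatives at the origin.  Continuity of the partial derivatives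
  nearby is part of the definition because the inverse function theorem asks for it.
\<close>

definition hol_germ :: "(complex \<times> complex \<Rightarrow> complex) \<Rightarrow> complex \<Rightarrow> complex \<Rightarrow> bool" where
  "hol_germ f a b \<longleftrightarrow> (\<exists>U A B. open U \<and> (0, 0) \<in> U \<and> continuous_on U A \<and> continuous_on U B \<and>
     A (0, 0) = a \<and> B (0, 0) = b \<and> (\<forall>p\<in>U. (f has_derivative (\<lambda>(h, k). A p * h + B p * k)) (at p)))"

lemma hol_germE:
  assumes "hol_germ f a b"
  obtains U A B where "open U" "(0, 0) \<in> U" "continuous_on U A" "continuous_on U B"
    "A (0, 0) = a" "B (0, 0) = b"
    "\<And>p. p \<in> U \<Longrightarrow> (f has_derivative (\<lambda>(h, k). A p * h + B p * k)) (at p)"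
    "continuous_on U f"
proof -
  from assms obtain U A B where *: "open U" "(0, 0) \<in> U" "continuous_on U A" "continuous_on U B"
    "A (0, 0) = a" "B (0, 0) = b"
    "\<And>p. p \<in> U \<Longrightarrow> (f has_derivative (\<lambda>(h, k). A p * h + B p * k)) (at p)"
    unfolding hol_germ_def by blast
  have "continuous_on U f"
    by (intro continuous_at_imp_continuous_on ballI has_derivative_continuous[OF *(7)])
  with * show ?thesis by (rule that)
qed

lemma hol_germI:
  assumes "open U" "(0, 0) \<in> U" "continuous_on U A" "continuous_on U B"
    "A (0, 0) = a" "B (0, 0) = b"
    "\<And>p. p \<in> U \<Longrightarrow> (f has_derivative (\<lambda>(h, k). A p * h + B p * k)) (at p)"
  shows "hol_germ f a b"
  using assms unfolding hol_germ_def by blast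

section \<open>Closure of germs under arithmetic, composition and roots\<close>

lemma hol_germ_const: "hol_germ (\<lambda>p. c) 0 0"
  by (rule hol_germI[where U = UNIV and A = "\<lambda>_. 0" and B = "\<lambda>_. 0"])
    (auto simp: case_prod_unfold)

lemma hol_germ_fst: "hol_germ fst 1 0"
  by (rule hol_germI[where U = UNIV and A = "\<lambda>_. 1" and B = "\<lambda>_. 0"])
    (auto simp: case_prod_unfold intro!: derivative_eq_intros)

lemma hol_germ_snd: "hol_germ snd 0 1"
  by (rule hol_germI[where U = UNIV and A = "\<lambda>_. 0" and B = "\<lambda>_. 1"])
    (auto simp: case_prod_unfold intro!: derivative_eq_intros)

lemma hol_germ_add:
  assumes "hol_germ f a b" "hol_germ g c d"
  shows "hol_germ (\<lambda>p. f p + g p) (a + c) (b + d)"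
proof -
  from assms(1) obtain U A B where U: "open U" "(0, 0) \<in> U" "continuous_on U A" "continuous_on U B"
    "A (0, 0) = a" "B (0, 0) = b"
    "\<And>p. p \<in> U \<Longrightarrow> (f has_derivative (\<lambda>(h, k). A p * h + B p * k)) (at p)"
    by (rule hol_germE) blast
  from assms(2) obtain V C D where V: "open V" "(0, 0) \<in> V" "continuous_on V C" "continuous_on V D"
    "C (0, 0) = c" "D (0, 0) = d"
    "\<And>p. p \<in> V \<Longrightarrow> (g has_derivative (\<lambda>(h, k). C p * h + D p * k)) (at p)"
    by (rule hol_germE) blast
  show ?thesis
  proof (rule hol_germI[where U = "U \<inter> V" and A = "\<lambda>p. A p + C p" and B = "\<lambda>p. B p + D p"])
    show "continuous_on (U \<inter> V) (\<lambda>p. A p + C p)" "continuous_on (U \<inter> V) (\<lambda>p. B p + D p)"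
      using U V by (auto intro!: continuous_intros elim: continuous_on_subset)
    show "((\<lambda>p. f p + g p) has_derivative (\<lambda>(h, k). (A p + C p) * h + (B p + D p) * k)) (at p)"
      if "p \<in> U \<inter> V" for p
      using has_derivative_add[OF U(7)[of p] V(7)[of p]] that
      by (simp add: case_prod_unfold algebra_simps)
  qed (use U V in auto)
qed

lemma hol_germ_mult:
  assumes "hol_germ f a b" "hol_germ g c d"
  shows "hol_germ (\<lambda>p. f p * g p) (f (0, 0) * c + a * g (0, 0)) (f (0, 0) * d + b * g (0, 0))"
proof -
  from assms(1) obtain U A B where U: "open U" "(0, 0) \<in> U" "continuous_on U A" "continuous_on U B"
    "A (0, 0) = a" "B (0, 0) = b"
    "\<And>p. p \<in> U \<Longrightarrow> (f has_derivative (\<lambda>(h, k). A p * h + B p * k)) (at p)" "continuous_on U f"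
    by (rule hol_germE) blast
  from assms(2) obtain V C D where V: "open V" "(0, 0) \<in> V" "continuous_on V C" "continuous_on V D"
    "C (0, 0) = c" "D (0, 0) = d"
    "\<And>p. p \<in> V \<Longrightarrow> (g has_derivative (\<lambda>(h, k). C p * h + D p * k)) (at p)" "continuous_on V g"
    by (rule hol_germE) blast
  show ?thesis
  proof (rule hol_germI[where U = "U \<inter> V" and A = "\<lambda>p. f p * C p + A p * g p"
        and B = "\<lambda>p. f p * D p + B p * g p"])
    show "continuous_on (U \<inter> V) (\<lambda>p. f p * C p + A p * g p)"
      "continuous_on (U \<inter> V) (\<lambda>p. f p * D p + B p * g p)"
      using U V by (auto intro!: continuous_intros elim: continuous_on_subset)
    show "((\<lambda>p. f p * g p) has_derivative
        (\<lambda>(h, k). (f p * C p + A p * g p) * h + (f p * D p + B p * g p) * k)) (at p)"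
      if "p \<in> U \<inter> V" for p
      using has_derivative_mult[OF U(7)[of p] V(7)[of p]] that
      by (simp add: case_prod_unfold algebra_simps)
  qed (use U V in auto)
qed

lemma hol_germ_compose:
  assumes "hol_germ f a b" "open S" "f (0, 0) \<in> S"
    and h: "\<And>z. z \<in> S \<Longrightarrow> (h has_field_derivative h' z) (at z)" "continuous_on S h'"
  shows "hol_germ (\<lambda>p. h (f p)) (h' (f (0, 0)) * a) (h' (f (0, 0)) * b)"
proof -
  from assms(1) obtain U A B where U: "open U" "(0, 0) \<in> U" "continuous_on U A" "continuous_on U B"
    "A (0, 0) = a" "B (0, 0) = b"
    "\<And>p. p \<in> U \<Longrightarrow> (f has_derivative (\<lambda>(h, k). A p * h + B p * k)) (at p)" "continuous_on U f"
    by (rule hol_germE) blast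
  define V where "V = U \<inter> f -` S"
  have "open V"
    unfolding V_def using continuous_open_preimage[OF U(8,1) assms(2)] .
  have c: "continuous_on V (\<lambda>p. h' (f p))"
    by (rule continuous_on_compose2[OF h(2)]) (auto simp: V_def intro: continuous_on_subset[OF U(8)])
  show ?thesis
  proof (rule hol_germI[where U = V and A = "\<lambda>p. h' (f p) * A p" and B = "\<lambda>p. h' (f p) * B p"])
    show "continuous_on V (\<lambda>p. h' (f p) * A p)" "continuous_on V (\<lambda>p. h' (f p) * B p)"
      using U c by (auto simp: V_def intro!: continuous_intros elim: continuous_on_subset)
    show "((\<lambda>p. h (f p)) has_derivative (\<lambda>(k, l). h' (f p) * A p * k + h' (f p) * B p * l)) (at p)"
      if "p \<in> V" for p
    proof -
      have "p \<in> U" "f p \<in> S" using that by (auto simp: V_def)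
      have "(h has_derivative (\<lambda>x. h' (f p) * x)) (at (f p))"
        using h(1)[OF \<open>f p \<in> S\<close>] by (simp add: has_field_derivative_def)
      from has_derivative_compose[OF U(7)[OF \<open>p \<in> U\<close>] this]
      show ?thesis by (simp add: case_prod_unfold algebra_simps)
    qed
  qed (use U assms \<open>open V\<close> in \<open>auto simp: V_def\<close>)
qed

lemma hol_germ_inverse:
  assumes "hol_germ f a b" "f (0, 0) \<noteq> 0"
  shows "hol_germ (\<lambda>p. inverse (f p)) (- (inverse (f (0, 0)))\<^sup>2 * a) (- (inverse (f (0, 0)))\<^sup>2 * b)"
  by (rule hol_germ_compose[OF assms(1), where S = "- {0}" and h' = "\<lambda>z. - (inverse z)\<^sup>2"])
    (use assms in \<open>auto intro!: derivative_eq_intros continuous_intros simp: power2_eq_square\<close>)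

lemma hol_germ_nonzero:
  assumes "hol_germ f a b" "f (0, 0) \<noteq> 0"
  shows "eventually (\<lambda>p. f p \<noteq> 0) (nhds (0, 0))"
proof -
  from assms(1) obtain U A B where U: "open U" "(0, 0) \<in> U"  "continuous_on U f"
    by (rule hol_germE) blast
  then have "open (U \<inter> f -` (- {0}))"
    by (intro continuous_open_preimage) auto
  then show ?thesis
    using assms U by (auto simp: eventually_nhds)
qed

text \<open>A branch of the root is composed with \<open>f\<close>; it exists because the value at
  the origin is not 0. Such roots later absorb unit coefficients into coordinates.\<close>

lemma hol_germ_root:
  assumes "hol_germ f a b" "f (0, 0) \<noteq> 0" "n > 0"
  obtains g c d where "hol_germ g c d" "g (0, 0) \<noteq> 0" "eventually (\<lambda>p. g p ^ n = f p) (nhds (0, 0))"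
proof -
  define w where "w = f (0, 0)"
  have w: "w \<noteq> 0" using assms by (simp add: w_def)
  \<comment> \<open>Dividing by \<open>w\<close> turns the cut of \<open>Ln\<close> to the ray
    opposite to \<open>w\<close>, so one formula serves every nonzero value.\<close>
  define S where "S = {z. z / w \<notin> \<real>\<^sub>\<le>\<^sub>0}"
  have S: "open S"
  proof -
    have "open ((\<lambda>z. z / w) -` (- \<real>\<^sub>\<le>\<^sub>0))"
      by (intro open_vimage continuous_intros) (use w in auto)
    then show ?thesis by (simp add: S_def vimage_def)
  qed
  define h where "h = (\<lambda>z. exp ((Ln (z / w) + Ln w) / of_nat n))"
  define h' where "h' = (\<lambda>z. h z * (inverse z / of_nat n))"
  have S0: "z \<noteq> 0" if "z \<in> S" for z
    using that by (auto simp: S_def)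
  have h: "(h has_field_derivative h' z) (at z)" if "z \<in> S" for z
  proof -
    have d: "((\<lambda>z. z / w) has_field_derivative inverse w) (at z)"
      using w by (auto intro!: derivative_eq_intros simp: field_simps)
    have "z / w \<notin> \<real>\<^sub>\<le>\<^sub>0"
      using that by (simp add: S_def)
    from DERIV_chain2[OF has_field_derivative_Ln[OF this] d]
    have ln: "((\<lambda>z. Ln (z / w)) has_field_derivative inverse z) (at z)"
      using w by (simp add: inverse_eq_divide)
    then have "((\<lambda>z. (Ln (z / w) + Ln w) / of_nat n) has_field_derivative inverse z / of_nat n) (at z)"
      by (intro DERIV_cdivide) (use DERIV_add[OF ln DERIV_const[of "Ln w"]] in simp)
    from DERIV_exp[THEN DERIV_chain2, OF this] show ?thesis
      by (simp add: h_def h'_def)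
  qed
  have "continuous_on S h"
    by (intro continuous_at_imp_continuous_on ballI DERIV_isCont[OF h])
  then have h': "continuous_on S h'"
    unfolding h'_def by (intro continuous_intros) (use S0 \<open>n > 0\<close> in auto)
  have g: "hol_germ (\<lambda>p. h (f p)) (h' (f (0, 0)) * a) (h' (f (0, 0)) * b)"
    by (rule hol_germ_compose[OF assms(1) S _ h h']) (use w in \<open>auto simp: S_def w_def\<close>)
  have "h z ^ n = z" if "z \<noteq> 0" for z
    using that w \<open>n > 0\<close> by (simp add: h_def exp_of_nat_mult[symmetric] exp_add)
  then have "eventually (\<lambda>p. h (f p) ^ n = f p) (nhds (0, 0))"
    using hol_germ_nonzero[OF assms(1,2)] by (auto elim: eventually_mono)
  moreover have "h (f (0, 0)) \<noteq> 0" by (simp add: h_def)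
  ultimately show ?thesis using that g by blast
qed


text \<open>The map (x, y) has invertible derivative at the origin, so the inverse function theorem
  applies. As \<open>isomorphic_germs\<close> compares \<open>f\<close> composed with \<phi> to
  \<open>g\<close>, \<phi> is the local inverse of (x, y), and the factor is the inverse of
  \<open>u\<close> composed with \<phi>.\<close>

lemma isomorphic_germs_of_coordinates:
  assumes x: "hol_germ x a b" "x (0, 0) = 0" and y: "hol_germ y c d" "y (0, 0) = 0"
    and det: "a * d - b * c \<noteq> 0"
    and u: "hol_germ u u1 u2" "u (0, 0) \<noteq> 0"
    and eq: "eventually (\<lambda>p. u p * f p = g (x p, y p)) (nhds (0, 0))"
  shows "isomorphic_germs f g"
proof -
  from x(1) obtain U1 A B where U1: "open U1" "(0, 0) \<in> U1" "continuous_on U1 A" "continuous_on U1 B"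
    "A (0, 0) = a" "B (0, 0) = b"
    "\<And>p. p \<in> U1 \<Longrightarrow> (x has_derivative (\<lambda>(h, k). A p * h + B p * k)) (at p)"
    by (rule hol_germE) blast
  from y(1) obtain U2 C D where U2: "open U2" "(0, 0) \<in> U2" "continuous_on U2 C" "continuous_on U2 D"
    "C (0, 0) = c" "D (0, 0) = d"
    "\<And>p. p \<in> U2 \<Longrightarrow> (y has_derivative (\<lambda>(h, k). C p * h + D p * k)) (at p)"
    by (rule hol_germE) blast
  from u(1) obtain U3 M N where U3: "open U3" "(0, 0) \<in> U3"
    "\<And>p. p \<in> U3 \<Longrightarrow> (u has_derivative (\<lambda>(h, k). M p * h + N p * k)) (at p)"
    by (rule hol_germE) blast
  have "eventually (\<lambda>p. u p * f p = g (x p, y p) \<and> u p \<noteq> 0) (nhds (0, 0))"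
    using eq hol_germ_nonzero[OF u] by eventually_elim auto
  then obtain U4 where U4: "open U4" "(0, 0) \<in> U4"
    "\<And>p. p \<in> U4 \<Longrightarrow> u p * f p = g (x p, y p) \<and> u p \<noteq> 0"
    unfolding eventually_nhds by blast
  define \<Delta> where "\<Delta> p = A p * D p - B p * C p" for p
  have cont: "continuous_on (U1 \<inter> U2) A" "continuous_on (U1 \<inter> U2) B"
    "continuous_on (U1 \<inter> U2) C" "continuous_on (U1 \<inter> U2) D"
    using U1 U2 by (auto elim: continuous_on_subset)
  \<comment> \<open>The Jacobian is invertible on all of \<open>U0\<close>, so the derivative of the
    inverse map can be written down at every point and not only at the origin.\<close>
  define U0 where "U0 = (U1 \<inter> U2) \<inter> \<Delta> -` (- {0})"
  have "open U0"
    unfolding U0_def \<Delta>_def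
    by (intro continuous_open_preimage continuous_intros cont) (use U1 U2 in auto)
  define W where "W = U0 \<inter> U3 \<inter> U4"
  have W: "open W" "(0, 0) \<in> W"
    using \<open>open U0\<close> U1 U2 U3 U4 det by (auto simp: W_def U0_def \<Delta>_def)
  define L where "L p = (\<lambda>(h, k). (A p * h + B p * k, C p * h + D p * k))" for p
  \<comment> \<open>Adjugate over determinant: the inverse function theorem returns the derivative
    only as \<open>inv\<close>, and this formula shows that it is complex-linear.\<close>
  define L' where "L' p = (\<lambda>(h, k). ((D p * h - B p * k) / \<Delta> p, (A p * k - C p * h) / \<Delta> p))" for p
  have bl: "bounded_linear (L p)" "bounded_linear (L' p)" for p
    unfolding L_def L'_def case_prod_unfold divide_inverse by (intro bounded_linear_intros)+
  have inv: "L' p (L p q) = q" "L p (L' p q) = q" if "\<Delta> p \<noteq> 0" for p q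
    using that by (cases q; simp add: L_def L'_def divide_simps; simp add: \<Delta>_def algebra_simps)+
  have L': "inv (L p) = L' p" if "\<Delta> p \<noteq> 0" for p
    using inv[OF that] by (intro inv_equality) auto
  define \<psi> where "\<psi> p = (x p, y p)" for p
  have psi: "(\<psi> has_derivative blinfun_apply (Blinfun (L p))) (at p)" if "p \<in> W" for p
    using that has_derivative_Pair[OF U1(7) U2(7), of p] bl
    by (simp add: \<psi>_def[abs_def] bounded_linear_Blinfun_apply L_def W_def U0_def case_prod_unfold)
  have "continuous_on W (\<lambda>p. Blinfun (L p))"
  proof (rule continuous_on_blinfun_componentwise)
    fix i :: "complex \<times> complex" assume "i \<in> Basis"
    have "continuous_on W A" "continuous_on W B" "continuous_on W C" "continuous_on W D"
      using cont by (auto simp: W_def U0_def elim!: continuous_on_subset)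
    then show "continuous_on W (\<lambda>p. blinfun_apply (Blinfun (L p)) i)"
      unfolding bounded_linear_Blinfun_apply[OF bl(1)] unfolding L_def case_prod_unfold
      by (intro continuous_intros)
  qed
  moreover have "Blinfun (L' (0, 0)) o\<^sub>L Blinfun (L (0, 0)) = id_blinfun"
    using W by (intro blinfun_eqI) (simp add: bounded_linear_Blinfun_apply bl inv W_def U0_def)
  ultimately obtain U V \<phi> \<phi>' where UV: "open U" "U \<subseteq> W" "(0, 0) \<in> U" "open V" "\<psi> (0, 0) \<in> V"
    "homeomorphism U V \<psi> \<phi>" "\<And>q. q \<in> V \<Longrightarrow> (\<phi> has_derivative \<phi>' q) (at q)"
    "\<And>q. q \<in> V \<Longrightarrow> \<phi>' q = inv (blinfun_apply (Blinfun (L (\<phi> q))))"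
    using inverse_function_theorem[OF W(1) psi, of "(0, 0)" "Blinfun (L' (0, 0))"] W by metis
  have phiU: "\<phi> q \<in> U" "\<psi> (\<phi> q) = q" if "q \<in> V" for q
    using UV(6) that by (auto simp: homeomorphism_def)
  have \<phi>': "(\<phi> has_derivative L' (\<phi> q)) (at q)" if "q \<in> V" for q
  proof -
    have "\<Delta> (\<phi> q) \<noteq> 0" using phiU[OF that] UV(2) by (auto simp: W_def U0_def)
    then show ?thesis
      using UV(7)[OF that] UV(8)[OF that] L' by (simp add: bounded_linear_Blinfun_apply bl)
  qed
  have \<psi>0: "\<psi> (0, 0) = (0, 0)" using x y by (simp add: \<psi>_def)
  have \<phi>0: "\<phi> (0, 0) = (0, 0)"
    using UV(3,6) \<psi>0 by (metis homeomorphism_apply1)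
  have hol1: "holomorphic2_on (fst \<circ> \<phi>) V" "holomorphic2_on (snd \<circ> \<phi>) V"
    unfolding holomorphic2_on_def
  proof safe
    fix p q assume "(p, q) \<in> V"
    note d = \<phi>'[OF this]
    show "\<exists>a b. (fst \<circ> \<phi> has_derivative (\<lambda>(h, k). a * h + b * k)) (at (p, q))"
      using has_derivative_fst[OF d]
      by (intro exI[of _ "D (\<phi> (p, q)) / \<Delta> (\<phi> (p, q))"] exI[of _ "- B (\<phi> (p, q)) / \<Delta> (\<phi> (p, q))"])
        (simp add: o_def L'_def case_prod_unfold diff_divide_distrib)
    show "\<exists>a b. (snd \<circ> \<phi> has_derivative (\<lambda>(h, k). a * h + b * k)) (at (p, q))"
      using has_derivative_snd[OF d]
      by (intro exI[of _ "- C (\<phi> (p, q)) / \<Delta> (\<phi> (p, q))"] exI[of _ "A (\<phi> (p, q)) / \<Delta> (\<phi> (p, q))"])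
        (simp add: o_def L'_def case_prod_unfold diff_divide_distrib)
  qed
  have hol2: "holomorphic2_on (fst \<circ> \<psi>) U" "holomorphic2_on (snd \<circ> \<psi>) U"
  proof -
    have "U \<subseteq> U1" "U \<subseteq> U2" using UV(2) by (auto simp: W_def U0_def)
    then show "holomorphic2_on (fst \<circ> \<psi>) U" "holomorphic2_on (snd \<circ> \<psi>) U"
      using U1(7) U2(7) unfolding holomorphic2_on_def \<psi>_def o_def fst_conv snd_conv by blast+
  qed
  have "biholomorphism V U \<phi> \<psi>"
    unfolding biholomorphism_def using UV hol1 hol2 homeomorphism_symD by blast
  moreover have "holomorphic2_on (\<lambda>q. inverse (u (\<phi> q))) V"
    unfolding holomorphic2_on_def
  proof
    fix q assume q: "q \<in> V"
    define p where "p = \<phi> q"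
    have "p \<in> U3" "p \<in> U4" using phiU[OF q] UV(2) by (auto simp: W_def p_def)
    with U4(3) have p: "p \<in> U3" "u p \<noteq> 0" by blast+
    have "((\<lambda>q. u (\<phi> q)) has_derivative (\<lambda>h. case L' p h of (h, k) \<Rightarrow> M p * h + N p * k)) (at q)"
      using has_derivative_compose[OF \<phi>'[OF q] U3(3)] p by (simp add: p_def)
    from Deriv.has_derivative_inverse[OF _ this] p
    have d: "((\<lambda>q. inverse (u (\<phi> q))) has_derivative
        (\<lambda>h. - (inverse (u p) * (case L' p h of (h, k) \<Rightarrow> M p * h + N p * k) * inverse (u p)))) (at q)"
      by (simp add: p_def)
    define v where "v = - (inverse (u p) * inverse (u p))"
    show "\<exists>a b. ((\<lambda>q. inverse (u (\<phi> q))) has_derivative (\<lambda>(h, k). a * h + b * k)) (at q)"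
      by (rule exI[of _ "v * (M p * D p - N p * C p) / \<Delta> p"],
          rule exI[of _ "v * (N p * A p - M p * B p) / \<Delta> p"], rule has_derivative_eq_rhs[OF d])
        (auto simp: L'_def v_def fun_eq_iff add_divide_distrib diff_divide_distrib algebra_simps)
  qed
  moreover have "inverse (u (\<phi> q)) \<noteq> 0 \<and> f (\<phi> q) = inverse (u (\<phi> q)) * g q" if "q \<in> V" for q
  proof -
    have "\<phi> q \<in> U4" using phiU[OF that] UV(2) by (auto simp: W_def)
    from U4(3)[OF this] phiU(2)[OF that] show ?thesis
      by (simp add: \<psi>_def field_simps)
  qed
  ultimately show ?thesis
    unfolding isomorphic_germs_def using UV(5) \<psi>0 \<phi>0 by (metis (no_types, lifting))
qed

lemma hol_germ_power_Suc:
  assumes "hol_germ f a b"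
  shows "hol_germ (\<lambda>p. f p ^ Suc n) (of_nat (Suc n) * f (0, 0) ^ n * a) (of_nat (Suc n) * f (0, 0) ^ n * b)"
proof (induction n)
  case (Suc n)
  show ?case
    using hol_germ_mult[OF assms Suc] by (simp add: algebra_simps)
qed (use assms in simp)

lemma hol_germ_power:
  assumes "hol_germ f a b"
  shows "hol_germ (\<lambda>p. f p ^ n) (of_nat n * f (0, 0) ^ (n - 1) * a) (of_nat n * f (0, 0) ^ (n - 1) * b)"
  using hol_germ_power_Suc[OF assms, of "n - 1"] by (cases n) (auto simp: hol_germ_const)

lemma hol_germ_diff:
  assumes "hol_germ f a b" "hol_germ g c d"
  shows "hol_germ (\<lambda>p. f p - g p) (a - c) (b - d)"
  using hol_germ_add[OF assms(1) hol_germ_mult[OF hol_germ_const[of "-1"] assms(2)]] by simp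

lemmas hol_germ_intros = hol_germ_const hol_germ_fst hol_germ_snd hol_germ_add hol_germ_diff hol_germ_mult
  hol_germ_power

text \<open>Forgets the partial derivatives: coefficients enter the normal forms only through their
  values at the origin, while coordinates need their differentials tracked.\<close>

definition holo :: "(complex \<times> complex \<Rightarrow> complex) \<Rightarrow> bool" where
  "holo f \<longleftrightarrow> (\<exists>a b. hol_germ f a b)"

lemma holo_of_hol_germ: "hol_germ f a b \<Longrightarrow> holo f"
  by (auto simp: holo_def)

lemma holo_const: "holo (\<lambda>p. c)"
  and holo_fst: "holo fst" "holo (\<lambda>p. fst p)"
  and holo_snd: "holo snd" "holo (\<lambda>p. snd p)"
  using hol_germ_const hol_germ_fst hol_germ_snd by (auto simp: holo_def)

lemma holo_add: "holo f \<Longrightarrow> holo g \<Longrightarrow> holo (\<lambda>p. f p + g p)"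
  unfolding holo_def using hol_germ_add by blast

lemma holo_mult: "holo f \<Longrightarrow> holo g \<Longrightarrow> holo (\<lambda>p. f p * g p)"
  unfolding holo_def using hol_germ_mult by blast

lemma holo_uminus: "holo f \<Longrightarrow> holo (\<lambda>p. - f p)"
  using holo_mult[OF holo_const[of "-1"]] by simp

lemma holo_diff: "holo f \<Longrightarrow> holo g \<Longrightarrow> holo (\<lambda>p. f p - g p)"
  using holo_add[OF _ holo_uminus] by simp

lemma holo_power: "holo f \<Longrightarrow> holo (\<lambda>p. f p ^ n)"
  by (induction n) (auto intro: holo_const holo_mult)

lemma holo_divide: "holo f \<Longrightarrow> holo g \<Longrightarrow> g (0, 0) \<noteq> 0 \<Longrightarrow> holo (\<lambda>p. f p / g p)"
  unfolding divide_inverse by (rule holo_mult) (auto simp: holo_def dest: hol_germ_inverse)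

lemmas holo_intros = holo_const holo_fst holo_snd holo_add holo_mult holo_uminus holo_diff holo_power holo_divide

text \<open>As \<open>f\<close> vanishes at the origin, the partials of \<open>g\<close> drop out of
  the product rule. A unit factor thus rescales the differential of a coordinate, and a vanishing
  factor kills it.\<close>

lemma hol_germ_mult_vanishing:
  assumes "hol_germ f a b" "f (0, 0) = 0" "holo g"
  shows "hol_germ (\<lambda>p. g p * f p) (g (0, 0) * a) (g (0, 0) * b)"
  using assms hol_germ_mult[of g _ _ f a b] by (fastforce simp: holo_def)

text \<open>With roots \<rho>^m = v and \<sigma>^n = w, the coordinates \<rho> x and \<sigma> y give
  the plain normal form; the Jacobian at the origin is only multiplied by nonzero values of \<rho>
  and \<sigma>.\<close>

lemma isomorphic_germs_normal_form:
  assumes x: "hol_germ x a b" "x (0, 0) = 0" and y: "hol_germ y c d" "y (0, 0) = 0"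
    and det: "a * d - b * c \<noteq> 0" and u: "holo u" "u (0, 0) \<noteq> 0"
    and v: "holo v" "v (0, 0) \<noteq> 0" and w: "holo w" "w (0, 0) \<noteq> 0" and "m > 0" "n > 0"
    and eq: "eventually (\<lambda>p. u p * f p = v p * x p ^ m + w p * y p ^ n) (nhds (0, 0))"
  shows "isomorphic_germs f (\<lambda>(x, y). x ^ m + y ^ n)"
proof -
  from v obtain v1 v2 where "hol_germ v v1 v2" by (auto simp: holo_def)
  from hol_germ_root[OF this v(2) \<open>m > 0\<close>] obtain \<rho> r1 r2
    where \<rho>: "hol_germ \<rho> r1 r2" "\<rho> (0, 0) \<noteq> 0" "eventually (\<lambda>p. \<rho> p ^ m = v p) (nhds (0, 0))"
    by blast
  from w obtain w1 w2 where "hol_germ w w1 w2" by (auto simp: holo_def)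
  from hol_germ_root[OF this w(2) \<open>n > 0\<close>] obtain \<sigma> s1 s2
    where \<sigma>: "hol_germ \<sigma> s1 s2" "\<sigma> (0, 0) \<noteq> 0" "eventually (\<lambda>p. \<sigma> p ^ n = w p) (nhds (0, 0))"
    by blast
  from u obtain u1 u2 where u': "hol_germ u u1 u2" by (auto simp: holo_def)
  show ?thesis
  proof (rule isomorphic_germs_of_coordinates[OF
        hol_germ_mult_vanishing[OF x holo_of_hol_germ[OF \<rho>(1)]] _
        hol_germ_mult_vanishing[OF y holo_of_hol_germ[OF \<sigma>(1)]] _ _ u' u(2)])
    have "\<rho> (0, 0) * \<sigma> (0, 0) * (a * d - b * c) \<noteq> 0"
      using \<rho> \<sigma> det by simp
    then show "\<rho> (0, 0) * a * (\<sigma> (0, 0) * d) - \<rho> (0, 0) * b * (\<sigma> (0, 0) * c) \<noteq> 0"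
      by (simp add: algebra_simps)
    show "\<forall>\<^sub>F p in nhds (0, 0). u p * f p =
        (case (\<rho> p * x p, \<sigma> p * y p) of (x, y) \<Rightarrow> x ^ m + y ^ n)"
      using eq \<rho>(3) \<sigma>(3) by eventually_elim (simp add: power_mult_distrib)
  qed (use x y in auto)
qed

lemma holo_nonzero:
  assumes "holo f" "f (0, 0) \<noteq> 0"
  shows "eventually (\<lambda>p. f p \<noteq> 0) (nhds (0, 0))"
  using assms hol_germ_nonzero by (auto simp: holo_def)

section \<open>Germs of type A and E6\<close>

lemma normal_form_A: "normal_form (Sing_A n) = (\<lambda>(x, y). x ^ 2 + y ^ (n + 1))"
  by auto

lemma normal_form_E6: "normal_form Sing_E6 = (\<lambda>(x, y). x ^ 3 + y ^ 4)"
  by auto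

text \<open>
  The germ of \<open>F2 ^ 3 + F3 ^ 2\<close> where the cubic \<open>b\<close> is smooth and meets the conic \<open>c b + w y ^ k\<close>
  with multiplicity \<open>k\<close>: completing the square in \<open>b\<close> removes the term linear in \<open>b\<close>.
\<close>

lemma isomorphic_germs_A:
  assumes b: "hol_germ b b1 b2" "b (0, 0) = 0" and y: "hol_germ y y1 y2" "y (0, 0) = 0"
    and det: "b1 * y2 - b2 * y1 \<noteq> 0"
    and h: "holo u" "holo A" "holo c" "holo w"
    and nz: "u (0, 0) \<noteq> 0" "A (0, 0) \<noteq> 0" "w (0, 0) \<noteq> 0" and k: "k > 0" "n + 1 = 3 * k"
    and eq: "\<And>p. u p * f p = A p * b p ^ 2 + (c p * b p + w p * y p ^ k) ^ 3"
  shows "isomorphic_germs f (normal_form (Sing_A n))"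
proof -
  have hb: "holo b" "holo y" using b y by (auto simp: holo_def)
  \<comment> \<open>With z = y^k, \<open>A1\<close> collects the terms of the expanded cube
    divisible by b^2, s y is half the linear coefficient 3 c w^2 z^2 over \<open>A1\<close>, and
    \<open>D\<close> is the coefficient of z^3 after completing the square. Splitting one y off z^2
    leaves the exponent 2 k - 1 > 0, so \<open>s\<close> vanishes at the origin and the differential
    of b is unchanged.\<close>
  define A1 where "A1 p = A p + c p ^ 3 * b p + 3 * c p ^ 2 * w p * y p ^ k" for p
  define s where "s p = 3 * c p * w p ^ 2 * y p ^ (2 * k - 1) / (2 * A1 p)" for p
  define D where "D p = w p ^ 3 - 9 * c p ^ 2 * w p ^ 4 * y p ^ k / (4 * A1 p)" for p
  have A1: "holo A1" "A1 (0, 0) \<noteq> 0"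
    using hb h nz b y k(1) unfolding A1_def[abs_def] by (auto intro!: holo_intros simp: zero_power)
  have s: "holo s" "s (0, 0) = 0"
    using A1 hb h y k(1) unfolding s_def[abs_def] by (auto intro!: holo_intros simp: zero_power)
  have D: "holo D" "D (0, 0) \<noteq> 0"
    using A1 hb h y k(1) nz unfolding D_def[abs_def] by (auto intro!: holo_intros simp: zero_power)
  have b1: "hol_germ (\<lambda>p. b p + s p * y p) (b1 + 0) (b2 + 0)"
    using hol_germ_add[OF b(1) hol_germ_mult_vanishing[OF y s(1)]] s by simp
  have "isomorphic_germs f (\<lambda>(x, y). x ^ 2 + y ^ (3 * k))"
  proof (rule isomorphic_germs_normal_form[OF b1 _ y _ h(1) nz(1) A1 D])
    show "\<forall>\<^sub>F p in nhds (0, 0). u p * f p = A1 p * (b p + s p * y p)\<^sup>2 + D p * y p ^ (3 * k)"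
      using holo_nonzero[OF A1]
    proof eventually_elim
      case (elim p)
      define z where "z = y p ^ k"
      have z: "y p ^ (2 * k - 1) * y p = z ^ 2" "y p ^ (3 * k) = z ^ 3"
        using k(1) power_minus_mult[of "2 * k" "y p"] by (simp_all add: z_def power_mult[symmetric] mult.commute)
      have sy: "s p * y p = 3 * c p * w p ^ 2 * z ^ 2 / (2 * A1 p)"
        by (simp add: s_def z(1)[symmetric])
      have "A1 p * (b p + 3 * c p * w p ^ 2 * z ^ 2 / (2 * A1 p))\<^sup>2
          = A1 p * b p ^ 2 + 3 * c p * w p ^ 2 * z ^ 2 * b p + 9 * c p ^ 2 * w p ^ 4 * z ^ 4 / (4 * A1 p)"
        using elim by (simp add: field_simps power2_eq_square power4_eq_xxxx)
      moreover have "D p * z ^ 3 = w p ^ 3 * z ^ 3 - 9 * c p ^ 2 * w p ^ 4 * z ^ 4 / (4 * A1 p)"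
        by (simp add: D_def z_def[symmetric] left_diff_distrib power4_eq_xxxx power3_eq_cube)
      moreover have "u p * f p = A1 p * b p ^ 2 + 3 * c p * w p ^ 2 * z ^ 2 * b p + w p ^ 3 * z ^ 3"
        unfolding eq A1_def z_def[symmetric] by algebra
      ultimately show ?case
        unfolding sy z(2) by simp
    qed
  qed (use b y det s k(1) in auto)
  then show ?thesis unfolding normal_form_A k(2) .
qed

text \<open>
  The germ of \<open>F2 ^ 3 + F3 ^ 2\<close> where the conic \<open>a\<close> is smooth and meets the cubic, which is singular,
  with multiplicity 2.  The shift \<open>t = y + r a\<close> removes the mixed term of the cubic; completing the
  cube in \<open>a\<close> then removes \<open>a\<^sup>2 t\<^sup>2\<close>, up to terms absorbed by the coefficient of \<open>t ^ 4\<close>.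
\<close>

lemma isomorphic_germs_E6:
  assumes a: "hol_germ a a1 a2" "a (0, 0) = 0" and y: "hol_germ y y1 y2" "y (0, 0) = 0"
    and det: "a1 * y2 - a2 * y1 \<noteq> 0"
    and h: "holo u" "holo A" "holo e" "holo g" "holo w"
    and nz: "u (0, 0) \<noteq> 0" "A (0, 0) \<noteq> 0" "w (0, 0) \<noteq> 0"
    and eq: "\<And>p. u p * f p = A p * a p ^ 3 + (e p * a p ^ 2 + g p * a p * y p + w p * y p ^ 2) ^ 2"
  shows "isomorphic_germs f (normal_form Sing_E6)"
proof -
  have hb: "holo a" "holo y" using a y by (auto simp: holo_def)
  \<comment> \<open>Completes the square in y: g = 2 w r, so the quadratic form becomes e' a^2 + w
    t^2.\<close>
  define r where "r p = g p / (2 * w p)" for p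
  define t where "t p = y p + r p * a p" for p
  define e' where "e' p = e p - g p ^ 2 / (4 * w p)" for p
  define A1 where "A1 p = A p + e' p ^ 2 * a p" for p
  \<comment> \<open>Solves 3 A1 m = 2 e' w, so that the cube of a + m t^2 supplies the mixed term 2
    e' w a^2 t^2. \<open>D\<close> compensates its last two terms, both divisible by t^4.\<close>
  define m where "m p = 2 * e' p * w p / (3 * A1 p)" for p
  define D where "D p = w p ^ 2 - 3 * A1 p * m p ^ 2 * a p - A1 p * m p ^ 3 * t p ^ 2" for p
  have r: "holo r"
    using h nz unfolding r_def[abs_def] by (auto intro!: holo_intros)
  have t0: "t (0, 0) = 0" using a y by (simp add: t_def)
  have t: "hol_germ t (y1 + r (0, 0) * a1) (y2 + r (0, 0) * a2)"
    unfolding t_def[abs_def] by (intro hol_germ_add y hol_germ_mult_vanishing a r)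
  have ht: "holo t" using t by (auto simp: holo_def)
  have e': "holo e'" using h nz unfolding e'_def[abs_def] by (auto intro!: holo_intros)
  have A1: "holo A1" "A1 (0, 0) \<noteq> 0"
    using e' hb h nz a unfolding A1_def[abs_def] by (auto intro!: holo_intros)
  have m: "holo m"
    using A1 e' h unfolding m_def[abs_def] by (auto intro!: holo_intros)
  have D: "holo D" "D (0, 0) \<noteq> 0"
    using A1 hb h m ht t0 a nz unfolding D_def[abs_def] by (auto intro!: holo_intros)
  \<comment> \<open>Read as (m t) t: the coefficient m t vanishes at the origin, so the differential
    of \<open>a\<close> is unchanged.\<close>
  have "hol_germ (\<lambda>p. a p + m p * t p * t p) (a1 + 0) (a2 + 0)"
    using hol_germ_add[OF a(1) hol_germ_mult_vanishing[OF t t0, of "\<lambda>p. m p * t p"]] m ht t0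
    by (auto intro: holo_mult)
  note a' = this
  have "isomorphic_germs f (\<lambda>(x, y). x ^ 3 + y ^ 4)"
  proof (rule isomorphic_germs_normal_form[OF a' _ t t0 _ h(1) nz(1) A1 D])
    show "\<forall>\<^sub>F p in nhds (0, 0). u p * f p = A1 p * (a p + m p * t p * t p) ^ 3 + D p * t p ^ 4"
      using holo_nonzero[OF A1] holo_nonzero[OF h(5) nz(3)]
    proof eventually_elim
      case (elim p)
      have gr: "g p = 2 * w p * r p" using elim by (simp add: r_def)
      have e: "e p = e' p + w p * r p ^ 2"
        using elim by (simp add: e'_def r_def field_simps power2_eq_square)
      have b: "e p * a p ^ 2 + g p * a p * y p + w p * y p ^ 2 = e' p * a p ^ 2 + w p * t p ^ 2"
        unfolding gr e t_def by algebra
      have em: "2 * (e' p * w p) = 3 * (A1 p * m p)" using elim by (simp add: m_def)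
      have "u p * f p = A1 p * a p ^ 3 + 2 * (e' p * w p) * a p ^ 2 * t p ^ 2 + w p ^ 2 * t p ^ 4"
        unfolding eq b A1_def by algebra
      also have "\<dots> = A1 p * (a p + m p * t p * t p) ^ 3 + D p * t p ^ 4"
        unfolding em D_def by algebra
      finally show ?case .
    qed
    show "(a1 + 0) * (y2 + r (0, 0) * a2) - (a2 + 0) * (y1 + r (0, 0) * a1) \<noteq> 0"
      using det by (simp add: algebra_simps)
  qed (use a t0 in auto)
  then show ?thesis by (simp add: normal_form_E6)
qed


section \<open>Forms and anticanonical sections\<close>

text \<open>\<open>0 ^ l\<close> is 1 for l = 0 and multiplicative in l. Hence the value turns sums
  of exponents into products, which makes \<open>form_eval\<close> a ring homomorphism.\<close>

definition monomial_value :: "complex ^ 3 \<Rightarrow> nat \<times> nat \<times> nat \<times> nat \<Rightarrow> complex" where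
  "monomial_value v = (\<lambda>(i, j, k, l). (v $ 1) ^ i * (v $ 2) ^ j * (v $ 3) ^ k * 0 ^ l)"

lemma monomial_value_add: "monomial_value v (q + r) = monomial_value v q * monomial_value v r"
  by (simp add: monomial_value_def case_prod_unfold power_add)

text \<open>Keys can cancel in a sum. A larger index set, on which missing keys contribute 0, serves
  several polynomials at once.\<close>

lemma form_eval_superset:
  assumes "finite S" "Poly_Mapping.keys F \<subseteq> S"
  shows "form_eval F v = (\<Sum>q\<in>S. Poly_Mapping.lookup F q * monomial_value v q)"
proof -
  have "form_eval F v = (\<Sum>q\<in>Poly_Mapping.keys F. Poly_Mapping.lookup F q * monomial_value v q)"
    by (simp add: form_eval_def monomial_value_def case_prod_unfold mult.assoc)
  also have "\<dots> = (\<Sum>q\<in>S. Poly_Mapping.lookup F q * monomial_value v q)"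
    using assms by (intro sum.mono_neutral_left) (auto simp: in_keys_iff)
  finally show ?thesis .
qed

lemma form_eval_zero [simp]: "form_eval 0 v = 0"
  by (simp add: form_eval_def)

lemma form_eval_single: "form_eval (Poly_Mapping.single q c) v = c * monomial_value v q"
  by (subst form_eval_superset[of "{q}"]) auto

lemma form_eval_mono4: "form_eval (mono4 i j k 0) v = (v $ 1) ^ i * (v $ 2) ^ j * (v $ 3) ^ k"
  by (simp add: mono4_def form_eval_single monomial_value_def)

lemma form_eval_add: "form_eval (F + G) v = form_eval F v + form_eval G v"
proof -
  define S where "S = Poly_Mapping.keys F \<union> Poly_Mapping.keys G"
  have S: "finite S" "Poly_Mapping.keys F \<subseteq> S" "Poly_Mapping.keys G \<subseteq> S" "Poly_Mapping.keys (F + G) \<subseteq> S"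
    using Poly_Mapping.keys_add[of F G] by (auto simp: S_def)
  show ?thesis
    by (simp add: form_eval_superset[OF S(1,2)] form_eval_superset[OF S(1,3)]
        form_eval_superset[OF S(1,4)] lookup_add sum.distrib distrib_right)
qed

lemma form_eval_sum: "form_eval (sum f I) v = (\<Sum>i\<in>I. form_eval (f i) v)"
  by (induction I rule: infinite_finite_induct) (simp_all add: form_eval_add)

lemma form_eval_diff: "form_eval (F - G) v = form_eval F v - form_eval G v"
  using form_eval_add[of "F - G" G v] by simp

lemma sum_singles_keys:
  "(\<Sum>q\<in>Poly_Mapping.keys F. Poly_Mapping.single q (Poly_Mapping.lookup F q)) = F"
  by (rule poly_mapping_eqI)
    (auto simp: lookup_sum lookup_single when_def in_keys_iff)

text \<open>Both factors are expanded into single monomials, on which the convolution product merely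
  adds exponents.\<close>

lemma form_eval_mult: "form_eval (F * G) v = form_eval F v * form_eval G v"
proof -
  have "F * G = (\<Sum>q\<in>Poly_Mapping.keys F. \<Sum>r\<in>Poly_Mapping.keys G.
      Poly_Mapping.single (q + r) (Poly_Mapping.lookup F q * Poly_Mapping.lookup G r))"
    unfolding mult_single[symmetric] sum_product[symmetric] sum_singles_keys ..
  then have "form_eval (F * G) v = (\<Sum>q\<in>Poly_Mapping.keys F. \<Sum>r\<in>Poly_Mapping.keys G.
      Poly_Mapping.lookup F q * Poly_Mapping.lookup G r * (monomial_value v q * monomial_value v r))"
    by (simp only: form_eval_sum form_eval_single monomial_value_add)
  then show ?thesis
    by (simp add: form_eval_superset[OF finite_keys order_refl] sum_product ac_simps)
qed

lemma form_eval_one [simp]: "form_eval 1 v = 1"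
  by (simp add: single_one[symmetric] form_eval_single monomial_value_def zero_prod_def del: single_one)

lemma form_eval_numeral [simp]: "form_eval (numeral n) v = numeral n"
  by (simp add: single_numeral[symmetric] form_eval_single monomial_value_def zero_prod_def del: single_numeral)

lemma form_eval_power: "form_eval (F ^ n) v = form_eval F v ^ n"
  by (induction n) (simp_all add: form_eval_mult)

lemmas form_eval_simps = form_eval_add form_eval_diff form_eval_mult form_eval_power

lemma form_eval_scale:
  assumes "ternary_form d F"
  shows "form_eval F (c *s v) = c ^ d * form_eval F v"
proof -
  have "monomial_value (c *s v) q = c ^ d * monomial_value v q" if "q \<in> Poly_Mapping.keys F" for q
    using assms that by (auto simp: ternary_form_def monomial_value_def power_mult_distrib power_add)
  then show ?thesis
    by (simp add: form_eval_superset[OF finite_keys order_refl] sum_distrib_left mult.left_commute)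
qed

text \<open>
  The edge of the polytope from \<open>(-1, 2, -1)\<close> to \<open>(3, -1, -1)\<close> is \<open>3 i + 4 j = 12\<close> in terms of the
  exponents \<open>i\<close> of \<open>X\<close> and \<open>j\<close> of \<open>Y\<close>.
\<close>

definition weighted_form :: "nat \<Rightarrow> nat \<Rightarrow> mpoly4 \<Rightarrow> bool" where
  "weighted_form d m F \<longleftrightarrow>
     (\<forall>(i, j, k, l) \<in> Poly_Mapping.keys F. l = 0 \<and> i + j + k = d \<and> m \<le> 3 * i + 4 * j)"

lemma weighted_form_numeral: "weighted_form 0 0 (numeral n)"
  by (simp add: weighted_form_def single_numeral[symmetric] zero_prod_def del: single_numeral)

lemma weighted_form_one: "weighted_form 0 0 1"
  by (simp add: weighted_form_def zero_prod_def)

lemma weighted_form_keys_Un: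
  assumes "weighted_form d m F" "weighted_form d' m' G" "d = d'"
    and "Poly_Mapping.keys H \<subseteq> Poly_Mapping.keys F \<union> Poly_Mapping.keys G"
  shows "weighted_form d (min m m') H"
  unfolding weighted_form_def
proof
  fix q assume "q \<in> Poly_Mapping.keys H"
  with assms(4) have "q \<in> Poly_Mapping.keys F \<or> q \<in> Poly_Mapping.keys G" by blast
  then show "case q of (i, j, k, l) \<Rightarrow> l = 0 \<and> i + j + k = d \<and> min m m' \<le> 3 * i + 4 * j"
    using assms(1-3) by (cases q) (auto simp: weighted_form_def dest!: bspec)
qed

text \<open>The degrees are separate variables joined by an equation, so that the rule also applies
  when the computed degrees agree only after simplification.\<close>

lemma weighted_form_add:
  "weighted_form d m F \<Longrightarrow> weighted_form d' m' G \<Longrightarrow> d = d' \<Longrightarrow> weighted_form d (min m m') (F + G)"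
  by (erule (2) weighted_form_keys_Un) (rule Poly_Mapping.keys_add)

lemma weighted_form_diff:
  "weighted_form d m F \<Longrightarrow> weighted_form d' m' G \<Longrightarrow> d = d' \<Longrightarrow> weighted_form d (min m m') (F - G)"
  by (erule (2) weighted_form_keys_Un) (auto simp: in_keys_iff lookup_minus)

lemma weighted_form_mult:
  assumes "weighted_form d m F" "weighted_form d' m' G"
  shows "weighted_form (d + d') (m + m') (F * G)"
  unfolding weighted_form_def
proof
  fix q assume "q \<in> Poly_Mapping.keys (F * G)"
  then obtain r s where rs: "r \<in> Poly_Mapping.keys F" "s \<in> Poly_Mapping.keys G" "q = r + s"
    using Poly_Mapping.keys_mult[of F G] by blast
  obtain r1 r2 r3 r4 s1 s2 s3 s4 where "r = (r1, r2, r3, r4)" "s = (s1, s2, s3, s4)"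
    by (metis prod.exhaust)
  with rs assms show "case q of (i, j, k, l) \<Rightarrow> l = 0 \<and> i + j + k = d + d' \<and> m + m' \<le> 3 * i + 4 * j"
    by (force simp: weighted_form_def)
qed

lemma weighted_form_power:
  assumes "weighted_form d m F"
  shows "weighted_form (n * d) (n * m) (F ^ n)"
  by (induction n) (simp_all add: weighted_form_one weighted_form_mult[OF assms])

text \<open>Starts the automatic weight computations: the introduction rules fill in
  \<open>d'\<close> and \<open>m'\<close>, and the side conditions compare them with the
  target.\<close>

lemma weighted_form_weaken:
  "weighted_form d' m' F \<Longrightarrow> d' = d \<Longrightarrow> m \<le> m' \<Longrightarrow> weighted_form d m F"
  unfolding weighted_form_def by fastforce

lemma ternary_form_of_weighted: "weighted_form d m F \<Longrightarrow> ternary_form d F"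
  unfolding weighted_form_def ternary_form_def by fastforce

section \<open>Lattice points of the polytope\<close>

lemma convex_hull_combination3:
  assumes "x \<in> S" "y \<in> S" "z \<in> S" "0 \<le> a" "0 \<le> b" "0 \<le> c" "a + b + c = (1 :: real)"
  shows "a *\<^sub>R x + b *\<^sub>R y + c *\<^sub>R z \<in> convex hull S"
proof -
  have "a *\<^sub>R x + b *\<^sub>R y + c *\<^sub>R z \<in> convex hull {x, y, z}"
    using assms by (auto simp: convex_hull_3)
  then show ?thesis
    using hull_mono[of "{x, y, z}" S] assms by blast
qed

text \<open>The face of the polytope at height \<open>-1\<close> is split along the diagonal from \<open>(-1, 2)\<close> to \<open>(5, -1)\<close>.\<close>

lemma Delta2_base:
  fixes x y :: real
  assumes "x \<ge> 0" "y \<ge> 0" "x + y \<le> 6" "3 * x + 4 * y \<ge> 12"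
  shows "(x - 1, y - 1, -1) \<in> Delta2"
proof (cases "x + 2 * y \<ge> 6")
  case True
  \<comment> \<open>Barycentric coordinates: each coefficient is the affine function that is 0 on
    the opposite edge and 1 at the vertex. In x and y the edges are x + y = 6, x = 0, x + 2 y = 6
    here, and y = 0, x + 2 y = 6, 3 x + 4 y = 12 in the other triangle.\<close>
  have "(2 - x / 3 - y / 3) *\<^sub>R (-1, 2, -1) + (x / 6) *\<^sub>R (5, -1, -1) + (y / 3 - 1 + x / 6) *\<^sub>R (-1, 5, -1)
      \<in> Delta2"
    unfolding Delta2_def by (rule convex_hull_combination3) (use assms True in auto)
  moreover have "(x - 1, y - 1, -1) =
      (2 - x / 3 - y / 3) *\<^sub>R (-1, 2, -1) + (x / 6) *\<^sub>R (5, -1, -1) + (y / 3 - 1 + x / 6) *\<^sub>R (-1, 5, -1 :: real)"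
    by (simp add: field_simps)
  ultimately show ?thesis by (simp only:)
next
  case False
  have "(y / 3) *\<^sub>R (-1, 2, -1) + (3 - y - x / 2) *\<^sub>R (3, -1, -1) + (x / 2 - 2 + 2 * y / 3) *\<^sub>R (5, -1, -1)
      \<in> Delta2"
    unfolding Delta2_def by (rule convex_hull_combination3) (use assms False in auto)
  moreover have "(x - 1, y - 1, -1) =
      (y / 3) *\<^sub>R (-1, 2, -1) + (3 - y - x / 2) *\<^sub>R (3, -1, -1) + (x / 2 - 2 + 2 * y / 3) *\<^sub>R (5, -1, -1 :: real)"
    by (simp add: field_simps)
  ultimately show ?thesis by (simp only:)
qed

text \<open>A sextic in X, Y, Z lives at height c = -1. There nonnegative exponents and the degree
  give three edges of the face, and the weight gives the fourth; \<open>W^2\<close> is the remaining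
  vertex.\<close>

lemma double_cover_anticanonical:
  assumes "weighted_form 6 12 F"
  shows "mono4 0 0 0 2 - F \<in> anticanonical_sections Delta2"
proof -
  have "(i, j, k, l) \<in> lattice_monomials Delta2" if q: "(i, j, k, l) \<in> Poly_Mapping.keys (mono4 0 0 0 2 - F)"
    for i j k l
  proof (cases "(i, j, k, l) = (0, 0, 0, 2)")
    case True
    have "(-1, -1, 1) \<in> Delta2"
      unfolding Delta2_def by (rule hull_inc) simp
    then have "(of_int (-1), of_int (-1), of_int 1) \<in> Delta2" by simp
    moreover have "int i = -1 + 1 \<and> int j = -1 + 1 \<and> int k = 1 - (-1) - (-1) - 3 * 1 \<and> int l = 1 + 1"
      using True by simp
    ultimately show ?thesis
      unfolding lattice_monomials_def by blast
  next
    case False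
    then have "(i, j, k, l) \<in> Poly_Mapping.keys F"
      using q by (auto simp: in_keys_iff lookup_minus mono4_def lookup_single when_def split: if_splits)
    then have *: "l = 0" "i + j + k = 6" "12 \<le> 3 * i + 4 * j"
      using assms by (auto simp: weighted_form_def)
    then have "(real i - 1, real j - 1, -1) \<in> Delta2"
      by (intro Delta2_base) linarith+
    then have "(of_int (int i - 1), of_int (int j - 1), of_int (-1)) \<in> Delta2" by simp
    moreover have "int i = (int i - 1) + 1 \<and> int j = (int j - 1) + 1 \<and>
        int k = 1 - (int i - 1) - (int j - 1) - 3 * (-1) \<and> int l = -1 + 1"
      using * by simp
    ultimately show ?thesis
      unfolding lattice_monomials_def by blast
  qed
  then show ?thesis by (auto simp: anticanonical_sections_def)
qed


section \<open>Torus curves over a fixed conic\<close>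

definition proj_point :: "complex ^ 3 \<Rightarrow> (complex ^ 3) set" where
  "proj_point v = proj_rel `` {v}"

lemma mem_proj_point: "w \<in> proj_point v \<longleftrightarrow> v \<noteq> 0 \<and> w \<noteq> 0 \<and> (\<exists>c. w = c *s v)"
  by (auto simp: proj_point_def proj_rel_def)

lemma proj_plane_iff: "P \<in> proj_plane \<longleftrightarrow> (\<exists>v. v \<noteq> 0 \<and> P = proj_point v)"
  by (auto simp: proj_plane_def quotient_def proj_point_def)

lemma proj_point_scale:
  assumes "c \<noteq> 0" "v \<noteq> 0"
  shows "proj_point (c *s v) = proj_point v"
proof -
  have "(\<exists>d. w = d *s (c *s v)) \<longleftrightarrow> (\<exists>d. w = d *s v)" for w
  proof
    assume "\<exists>d. w = d *s v"
    then obtain d where "w = d *s v" ..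
    then have "w = (d / c) *s (c *s v)" using assms by (simp add: vector_smult_assoc)
    then show "\<exists>d. w = d *s (c *s v)" ..
  qed (auto simp: vector_smult_assoc)
  then show ?thesis
    using assms by (simp add: set_eq_iff mem_proj_point)
qed

text \<open>Distinct points make \<open>map_of L\<close> an assignment of types; repeated types
  survive because the multiset is indexed by the points.\<close>

lemma has_configurationI:
  assumes "sing_points F = fst ` set L" "distinct (map fst L)"
    and "\<And>P \<tau>. (P, \<tau>) \<in> set L \<Longrightarrow> has_sing_type F P \<tau>"
  shows "has_configuration F (mset (map snd L))"
proof -
  define \<tau> where "\<tau> P = the (map_of L P)" for P
  have \<tau>: "\<tau> P = t" if "(P, t) \<in> set L" for P t
    using that assms(2) by (simp add: \<tau>_def map_of_is_SomeI)
  have "mset_set (sing_points F) = mset (map fst L)"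
    using assms(1,2) by (metis mset_set_set list.set_map)
  then have "image_mset \<tau> (mset_set (sing_points F)) = mset (map (\<tau> \<circ> fst) L)"
    by (simp add: image_mset.compositionality)
  also have "map (\<tau> \<circ> fst) L = map snd L"
    using \<tau> by (intro map_cong) auto
  finally show ?thesis
    unfolding has_configuration_def using assms \<tau> by (auto intro!: exI[of _ \<tau>])
qed

lemma torus_singular_iff:
  assumes F2: "(form_eval F2 has_derivative (\<lambda>h. a1 * h $ 1 + a2 * h $ 2 + a3 * h $ 3)) (at v)"
    and F3: "(form_eval F3 has_derivative (\<lambda>h. b1 * h $ 1 + b2 * h $ 2 + b3 * h $ 3)) (at v)"
  shows "form_eval (F2 ^ 3 + F3 ^ 2) v = 0 \<and> (form_eval (F2 ^ 3 + F3 ^ 2) has_derivative (\<lambda>h. 0)) (at v) \<longleftrightarrow>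
    form_eval F2 v ^ 3 + form_eval F3 v ^ 2 = 0 \<and>
    3 * form_eval F2 v ^ 2 * a1 + 2 * form_eval F3 v * b1 = 0 \<and>
    3 * form_eval F2 v ^ 2 * a2 + 2 * form_eval F3 v * b2 = 0 \<and>
    3 * form_eval F2 v ^ 2 * a3 + 2 * form_eval F3 v * b3 = 0"
proof -
  let ?c1 = "3 * form_eval F2 v ^ 2 * a1 + 2 * form_eval F3 v * b1"
  let ?c2 = "3 * form_eval F2 v ^ 2 * a2 + 2 * form_eval F3 v * b2"
  let ?c3 = "3 * form_eval F2 v ^ 2 * a3 + 2 * form_eval F3 v * b3"
  have eq: "form_eval (F2 ^ 3 + F3 ^ 2) = (\<lambda>v. form_eval F2 v ^ 3 + form_eval F3 v ^ 2)"
    by (simp add: fun_eq_iff form_eval_simps)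
  have d: "(form_eval (F2 ^ 3 + F3 ^ 2) has_derivative (\<lambda>h. ?c1 * h $ 1 + ?c2 * h $ 2 + ?c3 * h $ 3)) (at v)"
    unfolding eq by (rule has_derivative_eq_rhs[OF has_derivative_add[OF
          has_derivative_power[OF F2, where n = 3] has_derivative_power[OF F3, where n = 2]]])
      (simp add: fun_eq_iff algebra_simps)
  have "(form_eval (F2 ^ 3 + F3 ^ 2) has_derivative (\<lambda>h. 0)) (at v) \<longleftrightarrow> ?c1 = 0 \<and> ?c2 = 0 \<and> ?c3 = 0"
  proof
    assume "(form_eval (F2 ^ 3 + F3 ^ 2) has_derivative (\<lambda>h. 0)) (at v)"
    from has_derivative_unique[OF this d]
    have *: "?c1 * h $ 1 + ?c2 * h $ 2 + ?c3 * h $ 3 = 0" for h :: "complex ^ 3"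
      by metis
    show "?c1 = 0 \<and> ?c2 = 0 \<and> ?c3 = 0"
      using *[of "vector [1, 0, 0]"] *[of "vector [0, 1, 0]"] *[of "vector [0, 0, 1]"] by (simp only: vector_3) simp
  next
    assume "?c1 = 0 \<and> ?c2 = 0 \<and> ?c3 = 0"
    with d show "(form_eval (F2 ^ 3 + F3 ^ 2) has_derivative (\<lambda>h. 0)) (at v)" by simp
  qed
  then show ?thesis by (simp add: eq)
qed

section \<open>Coordinates and the fixed conic\<close>

definition X :: mpoly4 where "X = mono4 1 0 0 0"
definition Y :: mpoly4 where "Y = mono4 0 1 0 0"
definition Z :: mpoly4 where "Z = mono4 0 0 1 0"

lemma form_eval_XYZ: "form_eval X v = v $ 1" "form_eval Y v = v $ 2" "form_eval Z v = v $ 3"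
  by (simp_all add: X_def Y_def Z_def form_eval_mono4)

lemma weighted_form_XYZ: "weighted_form 1 3 X" "weighted_form 1 4 Y" "weighted_form 1 0 Z"
  by (simp_all add: X_def Y_def Z_def mono4_def weighted_form_def)

lemmas weighted_form_intros = weighted_form_XYZ weighted_form_numeral weighted_form_add
  weighted_form_diff weighted_form_mult weighted_form_power

definition conic_form :: mpoly4 where
  "conic_form = X\<^sup>2 - Y * Z"

lemma form_eval_conic: "form_eval conic_form v = (v $ 1)\<^sup>2 - v $ 2 * v $ 3"
  by (simp add: conic_form_def form_eval_simps form_eval_XYZ)

lemma weighted_form_conic: "weighted_form 2 4 conic_form"
  unfolding conic_form_def by (rule weighted_form_weaken, (rule weighted_form_intros | simp)+)

definition conic_point :: "complex \<Rightarrow> (complex ^ 3) set" where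
  "conic_point t = proj_point (vector [t, t\<^sup>2, 1])"

definition conic_infinity :: "(complex ^ 3) set" where
  "conic_infinity = proj_point (vector [0, 1, 0])"

lemma vector3_eq_iff: "(v :: complex ^ 3) = w \<longleftrightarrow> v $ 1 = w $ 1 \<and> v $ 2 = w $ 2 \<and> v $ 3 = w $ 3"
  by (simp add: vec_eq_iff forall_3)

lemma inj_conic_point: "conic_point s = conic_point t \<longleftrightarrow> s = t"
proof
  assume "conic_point s = conic_point t"
  moreover have "vector [s, s\<^sup>2, 1] \<in> conic_point s"
    by (auto simp: conic_point_def mem_proj_point vector3_eq_iff intro!: exI[of _ 1])
  ultimately show "s = t"
    by (auto simp: conic_point_def mem_proj_point vector3_eq_iff)
qed auto

lemma conic_infinity_neq: "conic_infinity \<noteq> conic_point t" "conic_point t \<noteq> conic_infinity"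
proof -
  have "vector [0, 1, 0] \<in> conic_infinity"
    by (auto simp: conic_infinity_def mem_proj_point vector3_eq_iff intro!: exI[of _ 1])
  moreover have "vector [0, 1, 0] \<notin> conic_point t"
    by (auto simp: conic_point_def mem_proj_point vector3_eq_iff)
  ultimately show "conic_infinity \<noteq> conic_point t" "conic_point t \<noteq> conic_infinity" by auto
qed

text \<open>
  Away from the intersection of conic and cubic, \<open>F2 ^ 3 + F3 ^ 2\<close> can only be singular
  where the pencil spanned by \<open>F2 ^ 3\<close> and \<open>F3 ^ 2\<close> is, i.e. where \<open>3 F3 dF2 = 2 F2 dF3\<close>.
\<close>

lemma sing_points_conic_torus:
  assumes G: "ternary_form 3 G"
    and d: "\<And>v. (form_eval G has_derivative (\<lambda>h. b1 v * h $ 1 + b2 v * h $ 2 + b3 v * h $ 3)) (at v)"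
    and outer: "\<And>v A B. \<lbrakk>A = (v $ 1)\<^sup>2 - v $ 2 * v $ 3; B = form_eval G v; A \<noteq> 0; B \<noteq> 0; A ^ 3 + B ^ 2 = 0;
      3 * B * v $ 1 = A * b1 v; - 3 * B * v $ 3 = 2 * A * b2 v; - 3 * B * v $ 2 = 2 * A * b3 v\<rbrakk> \<Longrightarrow> False"
  shows "sing_points (conic_form ^ 3 + G ^ 2) =
    conic_point ` {t. form_eval G (vector [t, t\<^sup>2, 1]) = 0} \<union>
    (if form_eval G (vector [0, 1, 0]) = 0 then {conic_infinity} else {})"
proof -
  have dc: "(form_eval conic_form has_derivative (\<lambda>h. (2 * v $ 1) * h $ 1 + (- v $ 3) * h $ 2 + (- v $ 2) * h $ 3)) (at v)"
    for v
    unfolding form_eval_conic[abs_def]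
    by (auto intro!: derivative_eq_intros bounded_linear.has_derivative[OF bounded_linear_vec_nth] simp: fun_eq_iff)
  define C where "C = form_eval conic_form"
  define E where "E = form_eval G"
  have sing: "form_eval (conic_form ^ 3 + G ^ 2) v = 0 \<and> (form_eval (conic_form ^ 3 + G ^ 2) has_derivative (\<lambda>h. 0)) (at v)
      \<longleftrightarrow> C v = 0 \<and> E v = 0" for v
  proof -
    have False if "C v \<noteq> 0" "C v ^ 3 + E v ^ 2 = 0" "3 * C v ^ 2 * (2 * v $ 1) + 2 * E v * b1 v = 0"
        "3 * C v ^ 2 * (- v $ 3) + 2 * E v * b2 v = 0" "3 * C v ^ 2 * (- v $ 2) + 2 * E v * b3 v = 0"
    proof -
      have E: "E v \<noteq> 0" using that by auto
      \<comment> \<open>Multiply the partial derivative by -C and replace C^3 by -E^2; a factor E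
        then cancels.\<close>
      have cancel: "3 * E v * a = 2 * C v * b" if "3 * C v ^ 2 * a + 2 * E v * b = 0" for a b
      proof -
        have "E v * (3 * E v * a - 2 * C v * b) = 0"
          using that \<open>C v ^ 3 + E v ^ 2 = 0\<close> by algebra
        then show ?thesis using E by simp
      qed
      show False
      proof (rule outer[of "C v" v "E v"])
        show "3 * E v * v $ 1 = C v * b1 v" using cancel[OF that(3)] by algebra
        show "- 3 * E v * v $ 3 = 2 * C v * b2 v" using cancel[OF that(4)] by algebra
        show "- 3 * E v * v $ 2 = 2 * C v * b3 v" using cancel[OF that(5)] by algebra
      qed (use that E in \<open>simp_all add: C_def E_def form_eval_conic\<close>)
    qed
    then show ?thesis
      unfolding torus_singular_iff[OF dc d, of v, folded C_def E_def] by (cases "C v = 0") auto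
  qed
  have scale: "C (c *s v) = c ^ 2 * C v" "E (c *s v) = c ^ 3 * E v" for c v
    unfolding C_def E_def
    using form_eval_scale[OF G] form_eval_scale[OF ternary_form_of_weighted[OF weighted_form_conic]] by auto
  have nz: "vector [t, t\<^sup>2, 1] \<noteq> (0 :: complex ^ 3)" "vector [0, 1, 0] \<noteq> (0 :: complex ^ 3)" for t
    by (auto simp: vector3_eq_iff)
  have mem: "proj_point v \<in> sing_points (conic_form ^ 3 + G ^ 2) \<longleftrightarrow> C v = 0 \<and> E v = 0" if "v \<noteq> 0" for v
  proof -
    have "v \<in> proj_point v" using that by (auto simp: mem_proj_point intro!: exI[of _ 1])
    then have "(\<forall>w\<in>proj_point v. C w = 0 \<and> E w = 0) \<longleftrightarrow> C v = 0 \<and> E v = 0"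
      by (auto simp: mem_proj_point scale)
    moreover have "proj_point v \<in> proj_plane" using that proj_plane_iff by blast
    ultimately show ?thesis by (simp add: sing_points_def sing)
  qed
  show ?thesis
  proof (intro equalityI subsetI)
    fix P assume P: "P \<in> sing_points (conic_form ^ 3 + G ^ 2)"
    then obtain v where v: "v \<noteq> 0" "P = proj_point v"
      by (auto simp: sing_points_def proj_plane_iff)
    with P mem have CE: "C v = 0" "E v = 0" by auto
    have C: "(v $ 1)\<^sup>2 = v $ 2 * v $ 3" using CE by (simp add: C_def form_eval_conic)
    show "P \<in> conic_point ` {t. form_eval G (vector [t, t\<^sup>2, 1]) = 0} \<union>
        (if form_eval G (vector [0, 1, 0]) = 0 then {conic_infinity} else {})"
    proof (cases "v $ 3 = 0")
      case True
      have eq: "v = (v $ 2) *s vector [0, 1, 0]"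
        using True C by (simp add: vector3_eq_iff)
      then have "v $ 2 \<noteq> 0" using v(1) by auto
      have "P = conic_infinity"
        unfolding v(2) conic_infinity_def by (subst eq) (rule proj_point_scale[OF \<open>v $ 2 \<noteq> 0\<close> nz(2)])
      moreover have "E (vector [0, 1, 0]) = 0"
        using CE(2) \<open>v $ 2 \<noteq> 0\<close> unfolding scale(2)[of "v $ 2" "vector [0, 1, 0]", folded eq] by simp
      ultimately show ?thesis by (simp add: E_def)
    next
      case False
      define t where "t = v $ 1 / v $ 3"
      have eq: "v = (v $ 3) *s vector [t, t\<^sup>2, 1]"
        using False C by (simp add: vector3_eq_iff t_def power2_eq_square)
      have "P = conic_point t"
        unfolding v(2) conic_point_def by (subst eq) (rule proj_point_scale[OF False nz(1)])
      moreover have "E (vector [t, t\<^sup>2, 1]) = 0"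
        using CE(2) False unfolding scale(2)[of "v $ 3" "vector [t, t\<^sup>2, 1]", folded eq] by simp
      ultimately show ?thesis by (auto simp: E_def)
    qed
  next
    fix P assume P: "P \<in> conic_point ` {t. form_eval G (vector [t, t\<^sup>2, 1]) = 0} \<union>
        (if form_eval G (vector [0, 1, 0]) = 0 then {conic_infinity} else {})"
    have C: "C (vector [t, t\<^sup>2, 1]) = 0" "C (vector [0, 1, 0]) = 0" for t
      by (simp_all add: C_def form_eval_conic)
    show "P \<in> sing_points (conic_form ^ 3 + G ^ 2)"
      using P mem[OF nz(1)] mem[OF nz(2)] C
      by (auto simp: conic_point_def conic_infinity_def E_def split: if_splits)
  qed
qed

text \<open>Isolates what varies from curve to curve, over three scalars: the partials of the cubic,
  the elimination off the conic, the zeros of the sextic and the local types.\<close>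

lemma conic_torus_example:
  assumes G: "weighted_form 3 6 G"
    and g: "form_eval G = (\<lambda>v. g (v $ 1) (v $ 2) (v $ 3))"
    and d: "\<And>v. (form_eval G has_derivative (\<lambda>h. gx (v $ 1) (v $ 2) (v $ 3) * h $ 1 +
      gy (v $ 1) (v $ 2) (v $ 3) * h $ 2 + gz (v $ 1) (v $ 2) (v $ 3) * h $ 3)) (at v)"
    and outer: "\<And>x y z A B. \<lbrakk>A = x\<^sup>2 - y * z; B = g x y z; A \<noteq> 0; B \<noteq> 0; A ^ 3 + B ^ 2 = 0;
      3 * B * x = A * gx x y z; - 3 * B * z = 2 * A * gy x y z; - 3 * B * y = 2 * A * gz x y z\<rbrakk> \<Longrightarrow> False"
    and L: "\<And>t. g t (t\<^sup>2) 1 = 0 \<longleftrightarrow> conic_point t \<in> fst ` set L"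
      "g 0 1 0 = 0 \<longleftrightarrow> conic_infinity \<in> fst ` set L"
      "fst ` set L \<subseteq> insert conic_infinity (range conic_point)" "distinct (map fst L)"
    and types: "\<And>P \<tau>. (P, \<tau>) \<in> set L \<Longrightarrow> ade \<tau> \<and> has_sing_type (conic_form ^ 3 + G ^ 2) P \<tau>"
    and M: "M = mset (map snd L)"
  shows "\<exists>F. torus_type_23 F \<and> has_configuration F M \<and> mono4 0 0 0 2 - F \<in> anticanonical_sections Delta2"
proof (intro exI conjI)
  note t = ternary_form_of_weighted[OF G] ternary_form_of_weighted[OF weighted_form_conic]
  have S_eq: "conic_point ` {t. conic_point t \<in> S} \<union> (if conic_infinity \<in> S then {conic_infinity} else {}) = S"
    if "S \<subseteq> insert conic_infinity (range conic_point)" for S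
    using that by (auto split: if_splits)
  have "sing_points (conic_form ^ 3 + G ^ 2) =
      conic_point ` {t. form_eval G (vector [t, t\<^sup>2, 1]) = 0} \<union>
      (if form_eval G (vector [0, 1, 0]) = 0 then {conic_infinity} else {})"
  proof (rule sing_points_conic_torus[OF t(1) d])
    fix v A B
    assume *: "A = (v $ 1)\<^sup>2 - v $ 2 * v $ 3" "B = form_eval G v" "A \<noteq> 0" "B \<noteq> 0" "A ^ 3 + B ^ 2 = 0"
      "3 * B * v $ 1 = A * gx (v $ 1) (v $ 2) (v $ 3)" "- 3 * B * v $ 3 = 2 * A * gy (v $ 1) (v $ 2) (v $ 3)"
      "- 3 * B * v $ 2 = 2 * A * gz (v $ 1) (v $ 2) (v $ 3)"
    show False
      by (rule outer[OF *(1) _ *(3-8)]) (simp add: *(2) g)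
  qed
  also have "\<dots> = fst ` set L"
    unfolding g vector_3 L(1,2) by (rule S_eq[OF L(3)])
  finally have S: "sing_points (conic_form ^ 3 + G ^ 2) = fst ` set L" .
  show "has_configuration (conic_form ^ 3 + G ^ 2) M"
    unfolding M using S L(4) types by (intro has_configurationI) auto
  show "mono4 0 0 0 2 - (conic_form ^ 3 + G ^ 2) \<in> anticanonical_sections Delta2"
    by (rule double_cover_anticanonical, rule weighted_form_weaken,
        (rule weighted_form_intros weighted_form_conic G | simp)+)
  \<comment> \<open>Otherwise every point of the conic would be singular, while \<open>S\<close>
    lists finitely many.\<close>
  have "conic_form ^ 3 + G ^ 2 \<noteq> 0"
  proof
    assume 0: "conic_form ^ 3 + G ^ 2 = 0"
    have 0: "form_eval (conic_form ^ 3 + G ^ 2) = (\<lambda>v. 0)"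
      by (simp add: 0 fun_eq_iff)
    have "range conic_point \<subseteq> sing_points (conic_form ^ 3 + G ^ 2)"
      unfolding sing_points_def 0 conic_point_def
      by (auto simp: proj_plane_iff vector3_eq_iff intro!: exI[of _ "vector [_, _, 1]"])
    then have "finite (range conic_point)"
      unfolding S by (rule finite_subset) simp
    moreover have "inj conic_point"
      by (simp add: inj_def inj_conic_point)
    ultimately show False
      using finite_imageD infinite_UNIV_char_0 by blast
  qed
  with t S types show "torus_type_23 (conic_form ^ 3 + G ^ 2)"
    unfolding torus_type_23_def by fastforce
qed

section \<open>Affine charts at the points of the conic\<close>

definition centred_chart :: "(complex ^ 3) set \<Rightarrow> (complex \<times> complex \<Rightarrow> complex ^ 3) \<Rightarrow> bool" where
  "centred_chart P \<kappa> \<longleftrightarrow> (\<exists>v d e. v \<in> P \<and> det (vector [v, d, e] :: complex ^ 3 ^ 3) \<noteq> 0 \<and>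
     (\<forall>s t. \<kappa> (s, t) = v + s *s d + t *s e))"

lemma has_sing_type_in_chart:
  assumes "centred_chart P \<kappa>" "isomorphic_germs (\<lambda>p. form_eval F (\<kappa> p)) (normal_form \<tau>)"
  shows "has_sing_type F P \<tau>"
proof -
  obtain v d e where *: "v \<in> P" "det (vector [v, d, e] :: complex ^ 3 ^ 3) \<noteq> 0"
    "\<And>s t. \<kappa> (s, t) = v + s *s d + t *s e"
    using assms(1) by (auto simp: centred_chart_def)
  then have "(\<lambda>p. form_eval F (\<kappa> p)) = (\<lambda>(s, t). form_eval F (v + s *s d + t *s e))"
    by auto
  with * assms(2) show ?thesis
    unfolding has_sing_type_def by auto
qed

lemma chart_conic_point_0: "centred_chart (conic_point 0) (\<lambda>(s, t). vector [s, t, 1])"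
  unfolding centred_chart_def
  by (rule exI[of _ "vector [0, 0, 1]"], rule exI[of _ "vector [1, 0, 0]"], rule exI[of _ "vector [0, 1, 0]"])
    (auto simp: conic_point_def mem_proj_point vector3_eq_iff det_3 intro!: exI[of _ 1])

lemma chart_conic_infinity: "centred_chart conic_infinity (\<lambda>(s, t). vector [s, 1, t])"
  unfolding centred_chart_def
  by (rule exI[of _ "vector [0, 1, 0]"], rule exI[of _ "vector [1, 0, 0]"], rule exI[of _ "vector [0, 0, 1]"])
    (auto simp: conic_infinity_def mem_proj_point vector3_eq_iff det_3 intro!: exI[of _ 1])

text \<open>The representative is [c : 1 : 1] with X kept fixed. In the curves singular at both 1
  and -1 only X^2 occurs, so one computation with c^2 = 1 serves both points.\<close>

lemma chart_conic_point_unit: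
  assumes "c\<^sup>2 = 1"
  shows "centred_chart (conic_point c) (\<lambda>(s, t). vector [c, 1 + s, 1 + t])"
proof -
  have "c \<noteq> 0" using assms by auto
  then show ?thesis
    unfolding centred_chart_def using assms
    by (intro exI[of _ "vector [c, 1, 1]"] exI[of _ "vector [0, 1, 0]"] exI[of _ "vector [0, 0, 1]"])
      (auto simp: conic_point_def mem_proj_point vector3_eq_iff det_3 intro!: exI[of _ 1])
qed

lemmas sing_type_A_in_chart = has_sing_type_in_chart[OF _ isomorphic_germs_A]
lemmas sing_type_E6_in_chart = has_sing_type_in_chart[OF _ isomorphic_germs_E6]

lemmas torus_eval = form_eval_add form_eval_diff form_eval_mult form_eval_power form_eval_numeral
  form_eval_conic form_eval_XYZ

lemmas chart_eval = split_paired_all case_prod_conv fst_conv snd_conv vector_3 torus_eval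
  power_one mult_1_left mult_1_right


section \<open>The six curves\<close>

text \<open>The sextic t^6 - 2 t^4 + t^2 = t^2 (t - 1)^2 (t + 1)^2 is lifted term by term. The lift
  of t^2 is X^2 Z, because Y Z^2 would make the cubic smooth at [0 : 0 : 1].\<close>

lemma torus_curve_2A5_E6:
  "\<exists>F. torus_type_23 F \<and> has_configuration F {#Sing_A 5, Sing_A 5, Sing_E6#} \<and>
    mono4 0 0 0 2 - F \<in> anticanonical_sections Delta2"
proof -
  let ?G = "Y^3 - 2 * X^2 * Y + X^2 * Z"
  let ?L = "[(conic_point 1, Sing_A 5), (conic_point (-1), Sing_A 5), (conic_point 0, Sing_E6)]"
  \<comment> \<open>With s = \<open>fst p\<close> and t = \<open>snd p\<close> the conic is a = s^2
    - t. Replacing t by s^2 - a and sorting the cubic by a and s gives the coefficients, inside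
    which t may remain. The other E6 points at 0 and infinity work alike.\<close>
  have type_0: "has_sing_type (conic_form ^ 3 + ?G ^ 2) (conic_point 0) Sing_E6"
    by (rule sing_type_E6_in_chart[where a = "\<lambda>p. fst p^2 - snd p" and y = fst and u = "\<lambda>p. 1"
          and A = "\<lambda>p. 1" and e = "\<lambda>p. 3 * fst p^2 - (fst p^2 - snd p)" and g = "\<lambda>p. 0"
          and w = "\<lambda>p. 1 - 2 * snd p - 3 * (fst p^2 - snd p) * fst p^2 + fst p^4",
          OF chart_conic_point_0],
        (rule hol_germ_intros holo_intros | (simp; fail))+,
        simp only: chart_eval, algebra)
  \<comment> \<open>Eliminating t = b - s - 3 s^2 - s^3 turns the conic 1 - (1 + s) (1 + t) into -
    (1 + s) b + (2 + s)^2 s^2.\<close>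
  have type_1: "has_sing_type (conic_form ^ 3 + ?G ^ 2) (conic_point c) (Sing_A 5)" if "c\<^sup>2 = 1" for c
    by (rule sing_type_A_in_chart[where b = "\<lambda>p. fst p + snd p + 3 * fst p^2 + fst p^3" and y = fst
          and u = "\<lambda>p. 1" and A = "\<lambda>p. 1" and c = "\<lambda>p. - (1 + fst p)"
          and w = "\<lambda>p. 4 + 4 * fst p + fst p^2" and k = 2,
          OF chart_conic_point_unit[OF that]],
        (rule hol_germ_intros holo_intros | (simp; fail))+,
        simp only: chart_eval that, algebra)
  show ?thesis
  proof (rule conic_torus_example[where G = ?G and L = ?L and g = "\<lambda>x y z. y^3 - 2 * x^2 * y + x^2 * z"
        and gx = "\<lambda>x y z. 2 * x * z - 4 * x * y"
        and gy = "\<lambda>x y z. 3 * y^2 - 2 * x^2" and gz = "\<lambda>x y z. x^2"])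
    show "weighted_form 3 6 ?G"
      by (rule weighted_form_weaken, (rule weighted_form_intros | simp)+)
    show ev: "form_eval ?G = (\<lambda>v. (v $ 2)^3 - 2 * (v $ 1)^2 * v $ 2 + (v $ 1)^2 * v $ 3)"
      by (rule ext) (simp only: torus_eval)
    show "(form_eval ?G has_derivative (\<lambda>h. (2 * v $ 1 * v $ 3 - 4 * v $ 1 * v $ 2) * h $ 1 +
        (3 * (v $ 2)^2 - 2 * (v $ 1)^2) * h $ 2 + ((v $ 1)^2) * h $ 3)) (at v)" for v
      unfolding ev
      by (auto intro!: derivative_eq_intros bounded_linear.has_derivative[OF bounded_linear_vec_nth]
          simp: fun_eq_iff algebra_simps power2_eq_square)
    show "(t^2)^3 - 2 * t^2 * t^2 + t^2 * 1 = 0 \<longleftrightarrow> conic_point t \<in> fst ` set ?L" for t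
    proof -
      have "(t^2)^3 - 2 * t^2 * t^2 + t^2 * 1 = t^2 * (t - 1)^2 * (t + 1)^2"
        by algebra
      then show ?thesis by (auto simp: inj_conic_point conic_infinity_neq add_eq_0_iff2)
    qed
  next
    fix x y z A B :: complex
    assume A: "A = x^2 - y * z" and B: "B = y^3 - 2 * x^2 * y + x^2 * z" and nz: "A \<noteq> 0" "B \<noteq> 0"
      and eq: "A ^ 3 + B ^ 2 = 0" "3 * B * x = A * (2 * x * z - 4 * x * y)"
        "- 3 * B * z = 2 * A * (3 * y^2 - 2 * x^2)" "- 3 * B * y = 2 * A * (x^2)"
    have "x \<noteq> 0"
      using eq(4) nz A by auto
    \<comment> \<open>This equation expresses B through A; in the other two a factor A then
      cancels.\<close>
    have "x * (3 * B + 2 * A * (2 * y - z)) = 0" using eq(2) by algebra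
    with \<open>x \<noteq> 0\<close> have 1: "3 * B = - 2 * A * (2 * y - z)" by (simp add: eq_neg_iff_add_eq_0)
    have "2 * A * (x^2 - (2 * y - z) * y) = 0" using 1 eq(4) by algebra
    with nz have x2: "x^2 = (2 * y - z) * y" by simp
    have "2 * A * ((2 * y - z) * z - 3 * y^2 + 2 * x^2) = 0" using 1 eq(3) by algebra
    with nz have "(2 * y - z) * z - 3 * y^2 + 2 * x^2 = 0" by simp
    then have "(y - z) * (y + z) = 0" using x2 by algebra
    moreover have "A = 2 * y * (y - z)" using A x2 by algebra
    ultimately have z: "z = - y" using nz by (auto simp: add_eq_0_iff)
    \<comment> \<open>The critical point left over has x^2 = 3 y^2, A = 4 y^2, B = - 8 y^3; it lies
      on another member of the pencil.\<close>
    have "128 * y^6 = 0" using eq(1) unfolding A B z using x2[unfolded z] by algebra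
    then show False using nz x2 z A by simp
  qed (use type_0 type_1 in \<open>auto simp: inj_conic_point conic_infinity_neq\<close>)
qed

text \<open>The cubic is the line X = 0 through the points 0 and infinity, taken twice, together
  with the tangent to the conic at 1.\<close>

lemma torus_curve_A5_2E6:
  "\<exists>F. torus_type_23 F \<and> has_configuration F {#Sing_A 5, Sing_E6, Sing_E6#} \<and>
    mono4 0 0 0 2 - F \<in> anticanonical_sections Delta2"
proof -
  let ?G = "X^2 * (Y - 2 * X + Z)"
  let ?L = "[(conic_point 1, Sing_A 5), (conic_point 0, Sing_E6), (conic_infinity, Sing_E6)]"
  have type_0: "has_sing_type (conic_form ^ 3 + ?G ^ 2) (conic_point 0) Sing_E6"
    by (rule sing_type_E6_in_chart[where a = "\<lambda>p. fst p^2 - snd p" and y = fst and u = "\<lambda>p. 1"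
          and A = "\<lambda>p. 1" and e = "\<lambda>p. 0" and g = "\<lambda>p. 0"
          and w = "\<lambda>p. snd p - 2 * fst p + 1",
          OF chart_conic_point_0],
        (rule hol_germ_intros holo_intros | (simp; fail))+,
        simp only: chart_eval, algebra)
  have type_infinity: "has_sing_type (conic_form ^ 3 + ?G ^ 2) (conic_infinity) Sing_E6"
    by (rule sing_type_E6_in_chart[where a = "\<lambda>p. fst p^2 - snd p" and y = fst and u = "\<lambda>p. 1"
          and A = "\<lambda>p. 1" and e = "\<lambda>p. 0" and g = "\<lambda>p. 0"
          and w = "\<lambda>p. 1 - 2 * fst p + snd p",
          OF chart_conic_infinity],
        (rule hol_germ_intros holo_intros | (simp; fail))+,
        simp only: chart_eval, algebra)
  have type_1: "has_sing_type (conic_form ^ 3 + ?G ^ 2) (conic_point 1) (Sing_A 5)"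
    by (rule sing_type_A_in_chart[where b = "\<lambda>p. fst p + snd p" and y = fst and u = "\<lambda>p. 1"
          and A = "\<lambda>p. 1" and c = "\<lambda>p. - (1 + fst p)" and w = "\<lambda>p. 1" and k = 2,
          OF chart_conic_point_unit[of 1]],
        (rule hol_germ_intros holo_intros | (simp; fail))+,
        simp only: chart_eval, algebra)
  show ?thesis
  proof (rule conic_torus_example[where G = ?G and L = ?L and g = "\<lambda>x y z. x^2 * (y - 2 * x + z)"
        and gx = "\<lambda>x y z. 2 * x * (y - 2 * x + z) - 2 * x^2"
        and gy = "\<lambda>x y z. x^2" and gz = "\<lambda>x y z. x^2"])
    show "weighted_form 3 6 ?G"
      by (rule weighted_form_weaken, (rule weighted_form_intros | simp)+)
    show ev: "form_eval ?G = (\<lambda>v. (v $ 1)^2 * (v $ 2 - 2 * v $ 1 + v $ 3))"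
      by (rule ext) (simp only: torus_eval)
    show "(form_eval ?G has_derivative (\<lambda>h. (2 * v $ 1 * (v $ 2 - 2 * v $ 1 + v $ 3) - 2 * (v $ 1)^2) * h $ 1 +
        ((v $ 1)^2) * h $ 2 + ((v $ 1)^2) * h $ 3)) (at v)" for v
      unfolding ev
      by (auto intro!: derivative_eq_intros bounded_linear.has_derivative[OF bounded_linear_vec_nth]
          simp: fun_eq_iff algebra_simps power2_eq_square)
    show "t^2 * (t^2 - 2 * t + 1) = 0 \<longleftrightarrow> conic_point t \<in> fst ` set ?L" for t
    proof -
      have "t^2 * (t^2 - 2 * t + 1) = t^2 * (t - 1)^2"
        by algebra
      then show ?thesis by (auto simp: inj_conic_point conic_infinity_neq add_eq_0_iff2)
    qed
  next
    fix x y z A B :: complex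
    assume A: "A = x^2 - y * z" and B: "B = x^2 * (y - 2 * x + z)" and nz: "A \<noteq> 0" "B \<noteq> 0"
      and eq: "A ^ 3 + B ^ 2 = 0" "3 * B * x = A * (2 * x * (y - 2 * x + z) - 2 * x^2)"
        "- 3 * B * z = 2 * A * (x^2)" "- 3 * B * y = 2 * A * (x^2)"
    have "3 * B * (y - z) = 0" using eq(3,4) by algebra
    with nz have z: "z = y" by simp
    have A': "A = (x - y) * (x + y)" and B': "B = - 2 * x^2 * (x - y)" using A B z by algebra+
    have "2 * x^2 * (x - y) * (3 * y - (x + y)) = 0" using eq(4) A' B' by algebra
    then have x: "x = 2 * y" using nz A' B' by auto
    \<comment> \<open>Here A = 3 y^2 and B = - 8 y^3.\<close>
    have "91 * y^6 = 0" using eq(1) A' B' x by algebra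
    then show False using nz A' x by simp
  qed (use type_0 type_infinity type_1 in \<open>auto simp: inj_conic_point conic_infinity_neq\<close>)
qed

text \<open>The cubic is the triangle inscribed in the conic with vertices 0, 1 and infinity, so it
  has a node at each of them.\<close>

lemma torus_curve_3E6:
  "\<exists>F. torus_type_23 F \<and> has_configuration F {#Sing_E6, Sing_E6, Sing_E6#} \<and>
    mono4 0 0 0 2 - F \<in> anticanonical_sections Delta2"
proof -
  let ?G = "X * (Y - X) * (Z - X)"
  let ?L = "[(conic_point 1, Sing_E6), (conic_point 0, Sing_E6), (conic_infinity, Sing_E6)]"
  have type_0: "has_sing_type (conic_form ^ 3 + ?G ^ 2) (conic_point 0) Sing_E6"
    by (rule sing_type_E6_in_chart[where a = "\<lambda>p. fst p^2 - snd p" and y = fst and u = "\<lambda>p. 1"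
          and A = "\<lambda>p. 1" and e = "\<lambda>p. 0" and g = "\<lambda>p. fst p - 1"
          and w = "\<lambda>p. - ((1 - fst p)^2)",
          OF chart_conic_point_0],
        (rule hol_germ_intros holo_intros | (simp; fail))+,
        simp only: chart_eval, algebra)
  have type_infinity: "has_sing_type (conic_form ^ 3 + ?G ^ 2) (conic_infinity) Sing_E6"
    by (rule sing_type_E6_in_chart[where a = "\<lambda>p. fst p^2 - snd p" and y = fst and u = "\<lambda>p. 1"
          and A = "\<lambda>p. 1" and e = "\<lambda>p. 0" and g = "\<lambda>p. fst p - 1"
          and w = "\<lambda>p. - ((1 - fst p)^2)",
          OF chart_conic_infinity],
        (rule hol_germ_intros holo_intros | (simp; fail))+,
        simp only: chart_eval, algebra)
  \<comment> \<open>The conic gives t = - (s + a) / (1 + s), so the cubic s t needs a factor 1 + s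
    to become polynomial in s and a; hence the unit (1 + s)^2.\<close>
  have type_1: "has_sing_type (conic_form ^ 3 + ?G ^ 2) (conic_point 1) Sing_E6"
    by (rule sing_type_E6_in_chart[where a = "\<lambda>p. 1 - (1 + fst p) * (1 + snd p)" and y = fst
          and u = "\<lambda>p. (1 + fst p)^2" and A = "\<lambda>p. (1 + fst p)^2" and e = "\<lambda>p. 0"
          and g = "\<lambda>p. -1" and w = "\<lambda>p. -1",
          OF chart_conic_point_unit[of 1]],
        (rule hol_germ_intros holo_intros | (simp; fail))+,
        simp only: chart_eval, algebra)
  show ?thesis
  proof (rule conic_torus_example[where G = ?G and L = ?L and g = "\<lambda>x y z. x * (y - x) * (z - x)"
        and gx = "\<lambda>x y z. (y - x) * (z - x) - x * (z - x) - x * (y - x)"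
        and gy = "\<lambda>x y z. x * (z - x)" and gz = "\<lambda>x y z. x * (y - x)"])
    show "weighted_form 3 6 ?G"
      by (rule weighted_form_weaken, (rule weighted_form_intros | simp)+)
    show ev: "form_eval ?G = (\<lambda>v. v $ 1 * (v $ 2 - v $ 1) * (v $ 3 - v $ 1))"
      by (rule ext) (simp only: torus_eval)
    show "(form_eval ?G has_derivative (\<lambda>h. ((v $ 2 - v $ 1) * (v $ 3 - v $ 1) - v $ 1 * (v $ 3 - v $ 1) - v $ 1 * (v $ 2 - v $ 1)) * h $ 1 +
        (v $ 1 * (v $ 3 - v $ 1)) * h $ 2 + (v $ 1 * (v $ 2 - v $ 1)) * h $ 3)) (at v)" for v
      unfolding ev
      by (auto intro!: derivative_eq_intros bounded_linear.has_derivative[OF bounded_linear_vec_nth]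
          simp: fun_eq_iff algebra_simps power2_eq_square)
    show "t * (t^2 - t) * (1 - t) = 0 \<longleftrightarrow> conic_point t \<in> fst ` set ?L" for t
    proof -
      have "t * (t^2 - t) * (1 - t) = - (t^2) * (t - 1)^2"
        by algebra
      then show ?thesis by (auto simp: inj_conic_point conic_infinity_neq add_eq_0_iff2)
    qed
  next
    fix x y z A B :: complex
    assume A: "A = x^2 - y * z" and B: "B = x * (y - x) * (z - x)" and nz: "A \<noteq> 0" "B \<noteq> 0"
      and eq: "A ^ 3 + B ^ 2 = 0" "3 * B * x = A * ((y - x) * (z - x) - x * (z - x) - x * (y - x))"
        "- 3 * B * z = 2 * A * (x * (z - x))" "- 3 * B * y = 2 * A * (x * (y - x))"
    define q r where "q = y - x" and "r = z - x"
    then have y: "y = q + x" and z: "z = r + x" by auto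
    have B': "B = x * q * r" and A': "A = - (q * r + q * x + x * r)" using A B y z by algebra+
    have nz': "x \<noteq> 0" "q \<noteq> 0" "r \<noteq> 0" using nz B' by auto
    have "x * r * (- 3 * q * (r + x) - 2 * A) = 0" using eq(3) B' y z by algebra
    then have 1: "2 * A = - 3 * q * (r + x)" using nz' by simp
    have "x * q * (- 3 * r * (q + x) - 2 * A) = 0" using eq(4) B' y z by algebra
    then have 2: "2 * A = - 3 * r * (q + x)" using nz' by simp
    have "3 * x * (q - r) = 0" using 1 2 by algebra
    then have r: "r = q" using nz' by simp
    have "q * (q - x) = 0" using 1 A' r by algebra
    then have q: "q = x" using nz' by simp
    \<comment> \<open>Here y = z = 2 x, A = - 3 x^2 and B = x^3.\<close>
    have "26 * x^6 = 0" using eq(1) A' B' r q by algebra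
    then show False using nz' by simp
  qed (use type_0 type_infinity type_1 in \<open>auto simp: inj_conic_point conic_infinity_neq\<close>)
qed

text \<open>The cubic consists of the tangent at infinity and the chords from 0 to 1 and from 0 to
  -1, which cross at 0 and meet the conic transversally at their other ends.\<close>

lemma torus_curve_2A2_A5_E6:
  "\<exists>F. torus_type_23 F \<and> has_configuration F {#Sing_A 2, Sing_A 2, Sing_A 5, Sing_E6#} \<and>
    mono4 0 0 0 2 - F \<in> anticanonical_sections Delta2"
proof -
  let ?G = "Z * (Y^2 - X^2)"
  let ?L = "[(conic_point 1, Sing_A 2), (conic_point (-1), Sing_A 2), (conic_infinity, Sing_A 5), (conic_point 0, Sing_E6)]"
  have type_0: "has_sing_type (conic_form ^ 3 + ?G ^ 2) (conic_point 0) Sing_E6"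
    by (rule sing_type_E6_in_chart[where a = "\<lambda>p. fst p^2 - snd p" and y = fst and u = "\<lambda>p. 1"
          and A = "\<lambda>p. 1" and e = "\<lambda>p. 1" and g = "\<lambda>p. 0"
          and w = "\<lambda>p. fst p^2 - 1 - 2 * (fst p^2 - snd p)",
          OF chart_conic_point_0],
        (rule hol_germ_intros holo_intros | (simp; fail))+,
        simp only: chart_eval, algebra)
  have type_infinity: "has_sing_type (conic_form ^ 3 + ?G ^ 2) (conic_infinity) (Sing_A 5)"
    by (rule sing_type_A_in_chart[where b = "\<lambda>p. snd p" and y = fst and u = "\<lambda>p. 1"
          and A = "\<lambda>p. (1 - fst p^2)^2" and c = "\<lambda>p. -1" and w = "\<lambda>p. 1" and k = 2,
          OF chart_conic_infinity],
        (rule hol_germ_intros holo_intros | (simp; fail))+,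
        simp only: chart_eval, algebra)
  \<comment> \<open>At a transversal point cubic and conic are themselves local coordinates, and
    their equation is already that of A2.\<close>
  have type_1: "has_sing_type (conic_form ^ 3 + ?G ^ 2) (conic_point c) (Sing_A 2)" if "c\<^sup>2 = 1" for c
    by (rule sing_type_A_in_chart[where b = "\<lambda>p. (1 + snd p) * ((1 + fst p)^2 - 1)"
          and y = "\<lambda>p. 1 - (1 + fst p) * (1 + snd p)" and u = "\<lambda>p. 1" and A = "\<lambda>p. 1"
          and c = "\<lambda>p. 0" and w = "\<lambda>p. 1" and k = 1,
          OF chart_conic_point_unit[OF that]],
        (rule hol_germ_intros holo_intros | (simp; fail))+,
        simp only: chart_eval that, algebra)
  show ?thesis
  proof (rule conic_torus_example[where G = ?G and L = ?L and g = "\<lambda>x y z. z * (y^2 - x^2)"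
        and gx = "\<lambda>x y z. - 2 * x * z"
        and gy = "\<lambda>x y z. 2 * y * z" and gz = "\<lambda>x y z. y^2 - x^2"])
    show "weighted_form 3 6 ?G"
      by (rule weighted_form_weaken, (rule weighted_form_intros | simp)+)
    show ev: "form_eval ?G = (\<lambda>v. v $ 3 * ((v $ 2)^2 - (v $ 1)^2))"
      by (rule ext) (simp only: torus_eval)
    show "(form_eval ?G has_derivative (\<lambda>h. (- 2 * v $ 1 * v $ 3) * h $ 1 +
        (2 * v $ 2 * v $ 3) * h $ 2 + ((v $ 2)^2 - (v $ 1)^2) * h $ 3)) (at v)" for v
      unfolding ev
      by (auto intro!: derivative_eq_intros bounded_linear.has_derivative[OF bounded_linear_vec_nth]
          simp: fun_eq_iff algebra_simps power2_eq_square)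
    show "1 * ((t^2)^2 - t^2) = 0 \<longleftrightarrow> conic_point t \<in> fst ` set ?L" for t
    proof -
      have "1 * ((t^2)^2 - t^2) = t^2 * (t - 1) * (t + 1)"
        by algebra
      then show ?thesis by (auto simp: inj_conic_point conic_infinity_neq add_eq_0_iff2)
    qed
  next
    fix x y z A B :: complex
    assume A: "A = x^2 - y * z" and B: "B = z * (y^2 - x^2)" and nz: "A \<noteq> 0" "B \<noteq> 0"
      and eq: "A ^ 3 + B ^ 2 = 0" "3 * B * x = A * (- 2 * x * z)"
        "- 3 * B * z = 2 * A * (2 * y * z)" "- 3 * B * y = 2 * A * (y^2 - x^2)"
    have nz': "z \<noteq> 0" "y^2 - x^2 \<noteq> 0" using nz B by auto
    have "z * (3 * B + 4 * A * y) = 0" using eq(3) by algebra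
    then have 1: "3 * B = - 4 * A * y" using nz' by (simp add: eq_neg_iff_add_eq_0)
    have "(y^2 - x^2) * (3 * y * z + 2 * A) = 0" using eq(4) B by algebra
    then have yz: "y * z = - 2 * x^2" using nz' A by simp algebra
    have A': "A = 3 * x^2" using A yz by algebra
    then have "x \<noteq> 0" using nz by auto
    have "x * (3 * B + 2 * A * z) = 0" using eq(2) by algebra
    with \<open>x \<noteq> 0\<close> have "3 * B + 2 * A * z = 0" by simp
    then have "2 * A * (z - 2 * y) = 0" using 1 by algebra
    then have z: "z = 2 * y" using nz by simp
    have y2: "y^2 = - (x^2)" using yz z by algebra
    \<comment> \<open>Here A = 3 x^2 and B = - 4 x^2 y, so B^2 = - 16 x^6.\<close>
    have "11 * x^6 = 0" using eq(1) A' B z y2 by algebra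
    then show False using \<open>x \<noteq> 0\<close> by simp
  qed (use type_0 type_infinity type_1 in \<open>auto simp: inj_conic_point conic_infinity_neq\<close>)
qed

text \<open>The cubic is the line X = 0 through 0 and infinity, taken twice, together with the chord
  Y = Z through 1 and -1.\<close>

lemma torus_curve_2A2_2E6:
  "\<exists>F. torus_type_23 F \<and> has_configuration F {#Sing_A 2, Sing_A 2, Sing_E6, Sing_E6#} \<and>
    mono4 0 0 0 2 - F \<in> anticanonical_sections Delta2"
proof -
  let ?G = "X^2 * (Y - Z)"
  let ?L = "[(conic_point 1, Sing_A 2), (conic_point (-1), Sing_A 2), (conic_point 0, Sing_E6), (conic_infinity, Sing_E6)]"
  have type_0: "has_sing_type (conic_form ^ 3 + ?G ^ 2) (conic_point 0) Sing_E6"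
    by (rule sing_type_E6_in_chart[where a = "\<lambda>p. fst p^2 - snd p" and y = fst and u = "\<lambda>p. 1"
          and A = "\<lambda>p. 1" and e = "\<lambda>p. 0" and g = "\<lambda>p. 0"
          and w = "\<lambda>p. snd p - 1",
          OF chart_conic_point_0],
        (rule hol_germ_intros holo_intros | (simp; fail))+,
        simp only: chart_eval, algebra)
  have type_infinity: "has_sing_type (conic_form ^ 3 + ?G ^ 2) (conic_infinity) Sing_E6"
    by (rule sing_type_E6_in_chart[where a = "\<lambda>p. fst p^2 - snd p" and y = fst and u = "\<lambda>p. 1"
          and A = "\<lambda>p. 1" and e = "\<lambda>p. 0" and g = "\<lambda>p. 0"
          and w = "\<lambda>p. 1 - snd p",
          OF chart_conic_infinity],
        (rule hol_germ_intros holo_intros | (simp; fail))+,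
        simp only: chart_eval, algebra)
  have type_1: "has_sing_type (conic_form ^ 3 + ?G ^ 2) (conic_point c) (Sing_A 2)" if "c\<^sup>2 = 1" for c
    by (rule sing_type_A_in_chart[where b = "\<lambda>p. fst p - snd p"
          and y = "\<lambda>p. 1 - (1 + fst p) * (1 + snd p)" and u = "\<lambda>p. 1" and A = "\<lambda>p. 1"
          and c = "\<lambda>p. 0" and w = "\<lambda>p. 1" and k = 1,
          OF chart_conic_point_unit[OF that]],
        (rule hol_germ_intros holo_intros | (simp; fail))+,
        simp only: chart_eval that, algebra)
  show ?thesis
  proof (rule conic_torus_example[where G = ?G and L = ?L and g = "\<lambda>x y z. x^2 * (y - z)"
        and gx = "\<lambda>x y z. 2 * x * (y - z)"
        and gy = "\<lambda>x y z. x^2" and gz = "\<lambda>x y z. - (x^2)"])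
    show "weighted_form 3 6 ?G"
      by (rule weighted_form_weaken, (rule weighted_form_intros | simp)+)
    show ev: "form_eval ?G = (\<lambda>v. (v $ 1)^2 * (v $ 2 - v $ 3))"
      by (rule ext) (simp only: torus_eval)
    show "(form_eval ?G has_derivative (\<lambda>h. (2 * v $ 1 * (v $ 2 - v $ 3)) * h $ 1 +
        ((v $ 1)^2) * h $ 2 + (- ((v $ 1)^2)) * h $ 3)) (at v)" for v
      unfolding ev
      by (auto intro!: derivative_eq_intros bounded_linear.has_derivative[OF bounded_linear_vec_nth]
          simp: fun_eq_iff algebra_simps power2_eq_square)
    show "t^2 * (t^2 - 1) = 0 \<longleftrightarrow> conic_point t \<in> fst ` set ?L" for t
    proof -
      have "t^2 * (t^2 - 1) = t^2 * (t - 1) * (t + 1)"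
        by algebra
      then show ?thesis by (auto simp: inj_conic_point conic_infinity_neq add_eq_0_iff2)
    qed
  next
    fix x y z A B :: complex
    assume A: "A = x^2 - y * z" and B: "B = x^2 * (y - z)" and nz: "A \<noteq> 0" "B \<noteq> 0"
      and eq: "A ^ 3 + B ^ 2 = 0" "3 * B * x = A * (2 * x * (y - z))"
        "- 3 * B * z = 2 * A * (x^2)" "- 3 * B * y = 2 * A * (- (x^2))"
    have "3 * B * (y + z) = 0" using eq(3,4) by algebra
    with nz have z: "z = - y" by (simp add: add_eq_0_iff)
    have A': "A = x^2 + y^2" and B': "B = 2 * x^2 * y" using A B z by algebra+
    have nz': "x \<noteq> 0" "y \<noteq> 0" using nz B' by auto
    have "2 * x * y * (x^2 - 2 * y^2) = 0" using eq(2) A' B' z by algebra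
    then have x2: "x^2 = 2 * y^2" using nz' by simp
    \<comment> \<open>Here A = 3 y^2 and B = 4 y^3.\<close>
    have "43 * y^6 = 0" using eq(1) A' B' x2 by algebra
    then show False using nz' by simp
  qed (use type_0 type_infinity type_1 in \<open>auto simp: inj_conic_point conic_infinity_neq\<close>)
qed

text \<open>The sextic t^2 (t - 1) lifts to X^2 (X - Z), which is singular at infinity as well.
  Subtracting Y times the conic keeps the restriction and makes the cubic smooth there, so that the
  triple zero gives A8.\<close>

lemma torus_curve_A2_E6_A8:
  "\<exists>F. torus_type_23 F \<and> has_configuration F {#Sing_A 2, Sing_E6, Sing_A 8#} \<and>
    mono4 0 0 0 2 - F \<in> anticanonical_sections Delta2"
proof -
  let ?G = "X^3 - X^2 * Z + Y^2 * Z - X^2 * Y"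
  let ?L = "[(conic_point 1, Sing_A 2), (conic_point 0, Sing_E6), (conic_infinity, Sing_A 8)]"
  have type_0: "has_sing_type (conic_form ^ 3 + ?G ^ 2) (conic_point 0) Sing_E6"
    by (rule sing_type_E6_in_chart[where a = "\<lambda>p. fst p^2 - snd p" and y = fst and u = "\<lambda>p. 1"
          and A = "\<lambda>p. 1" and e = "\<lambda>p. 1" and g = "\<lambda>p. 0"
          and w = "\<lambda>p. fst p - 1 - (fst p^2 - snd p)",
          OF chart_conic_point_0],
        (rule hol_germ_intros holo_intros | (simp; fail))+,
        simp only: chart_eval, algebra)
  \<comment> \<open>From the cubic, (1 - s^2) t = b + s^2 - s^3, hence (1 - s^2) (s^2 - t) = - b +
    (1 - s) s^3. The unit (1 - s^2)^3 clears the denominator of the cubed conic.\<close>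
  have type_infinity: "has_sing_type (conic_form ^ 3 + ?G ^ 2) (conic_infinity) (Sing_A 8)"
    by (rule sing_type_A_in_chart[where b = "\<lambda>p. fst p^3 - fst p^2 * snd p + snd p - fst p^2"
          and y = fst and u = "\<lambda>p. (1 - fst p^2)^3" and A = "\<lambda>p. (1 - fst p^2)^3"
          and c = "\<lambda>p. -1" and w = "\<lambda>p. 1 - fst p" and k = 3,
          OF chart_conic_infinity],
        (rule hol_germ_intros holo_intros | (simp; fail))+,
        simp only: chart_eval, algebra)
  have type_1: "has_sing_type (conic_form ^ 3 + ?G ^ 2) (conic_point 1) (Sing_A 2)"
    by (rule sing_type_A_in_chart[where 
          b = "\<lambda>p. 1 - (1 + snd p) + (1 + fst p)^2 * (1 + snd p) - (1 + fst p)"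
          and y = "\<lambda>p. 1 - (1 + fst p) * (1 + snd p)" and u = "\<lambda>p. 1" and A = "\<lambda>p. 1"
          and c = "\<lambda>p. 0" and w = "\<lambda>p. 1" and k = 1,
          OF chart_conic_point_unit[of 1]],
        (rule hol_germ_intros holo_intros | (simp; fail))+,
        simp only: chart_eval, algebra)
  show ?thesis
  proof (rule conic_torus_example[where G = ?G and L = ?L and g = "\<lambda>x y z. x^3 - x^2 * z + y^2 * z - x^2 * y"
        and gx = "\<lambda>x y z. 3 * x^2 - 2 * x * z - 2 * x * y"
        and gy = "\<lambda>x y z. 2 * y * z - x^2" and gz = "\<lambda>x y z. y^2 - x^2"])
    show "weighted_form 3 6 ?G"
      by (rule weighted_form_weaken, (rule weighted_form_intros | simp)+)
    show ev: "form_eval ?G = (\<lambda>v. (v $ 1)^3 - (v $ 1)^2 * v $ 3 + (v $ 2)^2 * v $ 3 - (v $ 1)^2 * v $ 2)"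
      by (rule ext) (simp only: torus_eval)
    show "(form_eval ?G has_derivative (\<lambda>h. (3 * (v $ 1)^2 - 2 * v $ 1 * v $ 3 - 2 * v $ 1 * v $ 2) * h $ 1 +
        (2 * v $ 2 * v $ 3 - (v $ 1)^2) * h $ 2 + ((v $ 2)^2 - (v $ 1)^2) * h $ 3)) (at v)" for v
      unfolding ev
      by (auto intro!: derivative_eq_intros bounded_linear.has_derivative[OF bounded_linear_vec_nth]
          simp: fun_eq_iff algebra_simps power2_eq_square)
    show "t^3 - t^2 * 1 + (t^2)^2 * 1 - t^2 * t^2 = 0 \<longleftrightarrow> conic_point t \<in> fst ` set ?L" for t
    proof -
      have "t^3 - t^2 * 1 + (t^2)^2 * 1 - t^2 * t^2 = t^2 * (t - 1)"
        by algebra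
      then show ?thesis by (auto simp: inj_conic_point conic_infinity_neq add_eq_0_iff2)
    qed
  next
    fix x y z A B :: complex
    assume A: "A = x^2 - y * z" and B: "B = x^3 - x^2 * z + y^2 * z - x^2 * y" and nz: "A \<noteq> 0" "B \<noteq> 0"
      and eq: "A ^ 3 + B ^ 2 = 0" "3 * B * x = A * (3 * x^2 - 2 * x * z - 2 * x * y)"
        "- 3 * B * z = 2 * A * (2 * y * z - x^2)" "- 3 * B * y = 2 * A * (y^2 - x^2)"
    \<comment> \<open>Cross-multiplying two of the equations by y and z eliminates B; the next
      elimination does the same with x and y.\<close>
    have "2 * A * (y^2 * z - x^2 * y + x^2 * z) = 0" using eq(3,4) by algebra
    then have 1: "y^2 * z - x^2 * y + x^2 * z = 0" using nz by simp
    have "A * x * (3 * x * y - 2 * y * z - 2 * x^2) = 0" using eq(2,4) by algebra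
    moreover have "x \<noteq> 0" using 1 nz A by auto
    ultimately have "3 * x * y - 2 * y * z - 2 * x^2 = 0" using nz by simp
    then have 2: "2 * y * z = 3 * x * y - 2 * x^2" by algebra
    then have "y \<noteq> 0" using \<open>x \<noteq> 0\<close> by auto
    have "x * ((x - y) * (2 * x^2 - x * y + 3 * y^2)) = 0" using 1 2 by algebra
    then have 3: "x = y \<or> 2 * x^2 - x * y + 3 * y^2 = 0" using \<open>x \<noteq> 0\<close> by simp
    have A': "2 * A = x * (4 * x - 3 * y)" using A 2 by algebra
    \<comment> \<open>Square the last equation of \<open>eq\<close> and replace B^2 by - A^3; with
      \<open>A'\<close> this leaves a second binary form in x and y.\<close>
    have "A^2 * (4 * (y^2 - x^2)^2 + 9 * A * y^2) = 0" using eq(1,4) by algebra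
    then have "4 * (y^2 - x^2)^2 + 9 * A * y^2 = 0" using nz by simp
    then have 4: "8 * (y^2 - x^2)^2 + 9 * x * (4 * x - 3 * y) * y^2 = 0" using A' by algebra
    from 3 show False
    proof
      assume "x = y"
      with 4 have "9 * y * (4 * y - 3 * y) * y^2 = 0" by simp
      then show False using \<open>y \<noteq> 0\<close> by simp
    next
      assume 5: "2 * x^2 - x * y + 3 * y^2 = 0"
      \<comment> \<open>Up to sign, the remainder of the quartic 4 modulo the quadratic 5.\<close>
      have "7 * y^3 * (y + 4 * x) = 0" using 4 5 by algebra
      then have "y = - 4 * x" using \<open>y \<noteq> 0\<close> by (simp add: add_eq_0_iff)
      then have "54 * x^2 = 0" using 5 by algebra
      then show False using \<open>x \<noteq> 0\<close> by simp
    qed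
  qed (use type_0 type_infinity type_1 in \<open>auto simp: inj_conic_point conic_infinity_neq\<close>)
qed

theorem proposition4p2:
  "\<forall>M \<in> {{#Sing_A 5, Sing_A 5, Sing_E6#},
          {#Sing_A 5, Sing_E6, Sing_E6#},
          {#Sing_E6, Sing_E6, Sing_E6#},
          {#Sing_A 2, Sing_A 2, Sing_A 5, Sing_E6#},
          {#Sing_A 2, Sing_A 2, Sing_E6, Sing_E6#},
          {#Sing_A 2, Sing_E6, Sing_A 8#}}.
     \<exists>F :: mpoly4. torus_type_23 F \<and> has_configuration F M \<and>
       mono4 0 0 0 2 - F \<in> anticanonical_sections Delta2"
  using torus_curve_2A5_E6 torus_curve_A5_2E6 torus_curve_3E6 torus_curve_2A2_A5_E6 torus_curve_2A2_2E6 torus_curve_A2_E6_A8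
  by blast

end
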